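(* Let $\mathcal A=(S,\mathcal R,\iota,F,\Delta)$ be a session automaton with $\mathcal R=\{1,\dots,k\}$. Then $L(\mathcal A)$ is $k$-bounded. Moreover, $\mathit{snf}(L(\mathcal A))$ is a regular language over the finite alphabet $\Sigma\times\Gamma_k$, where $\Gamma_k=\{r^\circledast,r^\uparrow : r\in\{1,\dots,k\}\}$, and a finite automaton recognizing it can be effectively computed whose number of states is at most linear in $|S|$ and exponential in $k$.
   Context: $\Sigma$ is a non-empty finite alphabet, $D$ an infinite set of data values; data words are elements of $(\Sigma\times D)^*$. A session automaton $(S,\mathcal R,\iota,F,\Delta)$ has finite non-empty state set $S$, finite non-empty register set $\mathcal R$, initial state $\iota$, final states $F\subseteq S$, and finitely many transitions $(s,(a,\pi),s')$ with $a\in\Sigma$, $\pi\in\{r^\circledast,r^\uparrow:r\in\mathcal R\}$. Configurations are $(s,\tau,U)$ with $\tau:\mathcal R\rightharpoonup D$ partial, $U\subseteq D$. Reading $(a,d)$ via a transition on register $r$ requires $d=\tau(r)$ if $\pi=r^\uparrow$ and $d\notin U$ if $\pi=r^\circledast$; then $\tau(r):=d$, $U:=U\cup\{d\}$. Runs start in $(\iota,\emptyset,\emptyset)$; $L(\mathcal A)$ is the set of data words having a run ending in $F$. A session of $w=(a_1,d_1)\cdots(a_n,d_n)$ is a set $\{\mathrm{first}_w(d),\dots,\mathrm{last}_w(d)\}$ where $d$ occurs in $w$ and $\mathrm{first}_w(d)$, $\mathrm{last}_w(d)$ are the first and last positions carrying $d$; $w$ is $k$-bounded if each position lies in at most $k$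 sessions, and a set of data words is $k$-bounded if all its elements are. Let $\Gamma=\{r^\circledast,r^\uparrow:r\in\mathbb N_{>0}\}$ and $\mathrm{reg}(r^\circledast)=\mathrm{reg}(r^\uparrow)=r$. The symbolic normal form $\mathit{snf}(w)=(a_1,\pi_1)\cdots(a_n,\pi_n)$ is defined with sets $\mathit{Free}(i)$: $\mathit{Free}(0)=\mathbb N_{>0}$; $\pi_i=(\min\mathit{Free}(i-1))^\circledast$ if $i=\mathrm{first}_w(d_i)$, else $\pi_i=(\mathrm{reg}(\pi_{\mathrm{first}_w(d_i)}))^\uparrow$; $\mathit{Free}(i)=\mathit{Free}(i-1)\setminus\{\min\mathit{Free}(i-1)\}$ if $i=\mathrm{first}_w(d_i)\ne\mathrm{last}_w(d_i)$, $\mathit{Free}(i-1)\cup\{\mathrm{reg}(\pi_i)\}$ if $i=\mathrm{last}_w(d_i)$, $\mathit{Free}(i-1)$ otherwise. $\mathit{snf}(L)=\{\mathit{snf}(w)\mid w\in L\}$. *)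

theory Defs
  imports Main "HOL-Library.Nat_Bijection" "HOL-Computational_Algebra.Polynomial"
begin

section \<open>Session automata\<close>

text \<open>\<open>Fresh r\<close> and \<open>Reuse r\<close> stand for $r^\circledast$ and $r^\uparrow$.\<close>

datatype 'r action = Fresh (reg: 'r) | Reuse (reg: 'r)

definition actions :: "'r set \<Rightarrow> 'r action set" where
  "actions R = Fresh ` R \<union> Reuse ` R"

abbreviation Gamma :: "nat \<Rightarrow> nat action set" where
  "Gamma k \<equiv> actions {1..k}"

record ('s, 'a, 'r) session_automaton =
  states :: "'s set"
  registers :: "'r set"
  initial :: 's
  final :: "'s set"
  transitions :: "('s \<times> ('a \<times> 'r action) \<times> 's) set"

definition is_session_automaton :: "'a set \<Rightarrow> ('s, 'a, 'r) session_automaton \<Rightarrow> bool" where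
  "is_session_automaton \<Sigma> A \<longleftrightarrow>
     finite (states A) \<and> states A \<noteq> {} \<and>
     finite (registers A) \<and> registers A \<noteq> {} \<and>
     initial A \<in> states A \<and> final A \<subseteq> states A \<and>
     finite (transitions A) \<and> transitions A \<subseteq> states A \<times> (\<Sigma> \<times> actions (registers A)) \<times> states A"

type_synonym ('a, 'd) data_word = "('a \<times> 'd) list"
type_synonym ('s, 'r, 'd) config = "'s \<times> ('r \<rightharpoonup> 'd) \<times> 'd set"

fun enabled :: "('r \<rightharpoonup> 'd) \<Rightarrow> 'd set \<Rightarrow> 'd \<Rightarrow> 'r action \<Rightarrow> bool" where
  "enabled \<tau> U d (Fresh r) \<longleftrightarrow> d \<notin> U"
| "enabled \<tau> U d (Reuse r) \<longleftrightarrow> \<tau> r = Some d"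

inductive run :: "('s, 'a, 'r) session_automaton \<Rightarrow> ('s, 'r, 'd) config \<Rightarrow>
    ('a, 'd) data_word \<Rightarrow> ('s, 'r, 'd) config \<Rightarrow> bool" for A where
  run_Nil: "run A c [] c"
| run_Cons: "\<lbrakk> (s, (a, \<pi>), s') \<in> transitions A; enabled \<tau> U d \<pi>;
      run A (s', \<tau>(reg \<pi> \<mapsto> d), insert d U) w c \<rbrakk> \<Longrightarrow> run A (s, \<tau>, U) ((a, d) # w) c"

definition sa_language ::
    "'a set \<Rightarrow> 'd set \<Rightarrow> ('s, 'a, 'r) session_automaton \<Rightarrow> ('a, 'd) data_word set" where
  "sa_language \<Sigma> D A = {w \<in> lists (\<Sigma> \<times> D).
     \<exists>s \<tau> U. run A (initial A, Map.empty, {}) w (s, \<tau>, U) \<and> s \<in> final A}"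

section \<open>Sessions and symbolic normal form\<close>

text \<open>Positions of words are counted from 0.\<close>

definition first_pos :: "('a, 'd) data_word \<Rightarrow> 'd \<Rightarrow> nat" where
  "first_pos w d = Min {i. i < length w \<and> snd (w ! i) = d}"

definition last_pos :: "('a, 'd) data_word \<Rightarrow> 'd \<Rightarrow> nat" where
  "last_pos w d = Max {i. i < length w \<and> snd (w ! i) = d}"

definition sessions :: "('a, 'd) data_word \<Rightarrow> nat set set" where
  "sessions w = {{first_pos w d..last_pos w d} | d. d \<in> snd ` set w}"

definition bounded_word :: "nat \<Rightarrow> ('a, 'd) data_word \<Rightarrow> bool" where
  "bounded_word k w \<longleftrightarrow> (\<forall>i < length w. card {I \<in> sessions w. i \<in> I} \<le> k)"

definition bounded_language :: "nat \<Rightarrow> ('a, 'd) data_word set \<Rightarrow> bool" where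
  "bounded_language k L \<longleftrightarrow> (\<forall>w \<in> L. bounded_word k w)"

text \<open>\<open>snf_prefix w i\<close> consists of the actions of the first \<open>i\<close> letters of \<open>snf w\<close>, together with
  the set $\mathit{Free}(i)$ of register names available after these letters. In the equation for
  \<open>Suc i\<close>, the letter being treated is \<open>w ! i\<close>.\<close>

primrec snf_prefix :: "('a, 'd) data_word \<Rightarrow> nat \<Rightarrow> nat action list \<times> nat set" where
  "snf_prefix w 0 = ([], {1..})"
| "snf_prefix w (Suc i) =
     (let (\<pi>s, Free) = snf_prefix w i;
          d = snd (w ! i);
          m = (LEAST r. r \<in> Free);
          \<pi> = (if i = first_pos w d then Fresh m else Reuse (reg (\<pi>s ! first_pos w d)));
          Free' = (if i = first_pos w d \<and> i \<noteq> last_pos w d then Free - {m}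
                   else if i = last_pos w d then Free \<union> {reg \<pi>}
                   else Free)
      in (\<pi>s @ [\<pi>], Free'))"

definition snf :: "('a, 'd) data_word \<Rightarrow> ('a \<times> nat action) list" where
  "snf w = zip (map fst w) (fst (snf_prefix w (length w)))"

section \<open>Finite automata and regular languages\<close>

record ('q, 'l) nfa =
  nfa_states :: "'q set"
  nfa_initial :: 'q
  nfa_final :: "'q set"
  nfa_trans :: "('q \<times> 'l \<times> 'q) set"

definition is_nfa :: "'l set \<Rightarrow> ('q, 'l) nfa \<Rightarrow> bool" where
  "is_nfa \<Lambda> B \<longleftrightarrow> finite \<Lambda> \<and> finite (nfa_states B) \<and>
     nfa_initial B \<in> nfa_states B \<and> nfa_final B \<subseteq> nfa_states B \<and>
     nfa_trans B \<subseteq> nfa_states B \<times> \<Lambda> \<times> nfa_states B"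

inductive nfa_run :: "('q, 'l) nfa \<Rightarrow> 'q \<Rightarrow> 'l list \<Rightarrow> 'q \<Rightarrow> bool" for B where
  nfa_run_Nil: "nfa_run B q [] q"
| nfa_run_Cons: "\<lbrakk> (q, x, q') \<in> nfa_trans B; nfa_run B q' u q'' \<rbrakk> \<Longrightarrow> nfa_run B q (x # u) q''"

definition nfa_language :: "('q, 'l) nfa \<Rightarrow> 'l list set" where
  "nfa_language B = {u. \<exists>q \<in> nfa_final B. nfa_run B (nfa_initial B) u q}"

definition regular :: "'l set \<Rightarrow> 'l list set \<Rightarrow> bool" where
  "regular \<Lambda> L \<longleftrightarrow> (\<exists>B :: (nat, 'l) nfa. is_nfa \<Lambda> B \<and> nfa_language B = L)"

section \<open>Computable functions\<close>

text \<open>\<open>recursive n f\<close>: on argument lists of length \<open>n\<close>, \<open>f\<close> is a total recursive function, in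
  Kleene's sense of closure under composition, primitive recursion and minimization of regular
  functions. Values of \<open>f\<close> on lists of other lengths are irrelevant.\<close>

inductive recursive :: "nat \<Rightarrow> (nat list \<Rightarrow> nat) \<Rightarrow> bool" where
  rec_zero: "recursive n (\<lambda>xs. 0)"
| rec_Suc: "recursive 1 (\<lambda>xs. Suc (xs ! 0))"
| rec_proj: "i < n \<Longrightarrow> recursive n (\<lambda>xs. xs ! i)"
| rec_comp: "\<lbrakk> recursive (length gs) f; \<forall>g \<in> set gs. recursive n g \<rbrakk> \<Longrightarrow>
    recursive n (\<lambda>xs. f (map (\<lambda>g. g xs) gs))"
| rec_primrec: "\<lbrakk> recursive n f; recursive (Suc (Suc n)) g \<rbrakk> \<Longrightarrow>
    recursive (Suc n) (\<lambda>xs. rec_nat (f (tl xs)) (\<lambda>y z. g (y # z # tl xs)) (hd xs))"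
| rec_mu: "\<lbrakk> recursive (Suc n) f; \<forall>xs. length xs = n \<longrightarrow> (\<exists>y. f (y # xs) = 0) \<rbrakk> \<Longrightarrow>
    recursive n (\<lambda>xs. LEAST y. f (y # xs) = 0)"

definition computable :: "(nat \<Rightarrow> nat) \<Rightarrow> bool" where
  "computable f \<longleftrightarrow> (\<exists>g. recursive 1 g \<and> (\<forall>x. f x = g [x]))"

text \<open>Automata are presented to an algorithm as numbers, relative to a numbering \<open>es\<close> of the states
  and a numbering \<open>ea\<close> of \<open>\<Sigma>\<close>. A finite set of numbers is coded by \<^const>\<open>set_encode\<close>, that is, by
  its characteristic bit sequence.\<close>

fun action_code :: "nat action \<Rightarrow> nat" where
  "action_code (Fresh r) = sum_encode (Inl r)"
| "action_code (Reuse r) = sum_encode (Inr r)"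

definition letter_code :: "('a \<Rightarrow> nat) \<Rightarrow> 'a \<times> nat action \<Rightarrow> nat" where
  "letter_code ea = (\<lambda>(a, \<pi>). prod_encode (ea a, action_code \<pi>))"

definition trans_code :: "('q \<Rightarrow> nat) \<Rightarrow> ('l \<Rightarrow> nat) \<Rightarrow> ('q \<times> 'l \<times> 'q) set \<Rightarrow> nat" where
  "trans_code eq el T =
     set_encode ((\<lambda>(q, x, q'). prod_encode (eq q, prod_encode (el x, eq q'))) ` T)"

definition sa_code :: "('s \<Rightarrow> nat) \<Rightarrow> ('a \<Rightarrow> nat) \<Rightarrow> ('s, 'a, nat) session_automaton \<Rightarrow> nat" where
  "sa_code es ea A = list_encode
     [set_encode (es ` states A), set_encode (registers A), es (initial A),
      set_encode (es ` final A), trans_code es (letter_code ea) (transitions A)]"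

definition nfa_code :: "('a \<Rightarrow> nat) \<Rightarrow> (nat, 'a \<times> nat action) nfa \<Rightarrow> nat" where
  "nfa_code ea B = list_encode
     [set_encode (nfa_states B), nfa_initial B,
      set_encode (nfa_final B), trans_code id (letter_code ea) (nfa_trans B)]"

end

theory Submission
  imports Defs
begin

text \<open>In a run, a data value that has already been read can only be read again while some register
  still holds it, so the sessions around a position inject into the registers; this gives
  \<open>k\<close>-boundedness. For regularity, simulate the session automaton while reading a normal form: besides
  the current state it suffices to remember which register holds the live value named \<open>m\<close> in the
  normal form. The free names are then the unused \<open>m\<close>, a live register must not be overwritten, and the
  automaton guesses at each letter whether its session ends there, accepting only when no value is
  left live. A state is thus a state of the session automaton with a relation on \<open>{1..k}\<close>, whence at most
  \<open>card S * 2 ^ (k * k)\<close> states. All components of the automaton are finite sets cut out by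
  bounded-quantifier arithmetic predicates, so its code is a recursive function of the code of the
  session automaton.\<close>

section \<open>A position-free description of the symbolic normal form\<close>

text \<open>\<open>snf\<close> depends on absolute positions and on whether a letter ends its
  session, a fact about the unread part of the word. In \<open>suffix_snf\<close> all that matters
  of the past is in \<open>\<mu>\<close>, and the only look-ahead is whether \<open>d\<close>
  recurs: one bit per letter, which an automaton can guess. The two language inclusions treat that
  bit differently. A given word determines it; from an accepting run a word is built with new values
  of the infinite set \<open>D\<close>, and emptiness of the final relation certifies, from the end
  backwards, that each bit was right. Names never exceed \<open>k\<close>, because the names in use
  at a fresh letter belong to values in distinct registers other than the one being written. The
  code is therefore computed without exploring any automaton: each set is cut out of the numbers
  below an explicit bound.\<close>

text \<open>The map \<open>\<mu>\<close> sends each live data value, i.e. one that has occurred and will occur again, to its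
  register name.\<close>

fun suffix_snf :: "('d \<rightharpoonup> nat) \<Rightarrow> ('a, 'd) data_word \<Rightarrow> ('a \<times> nat action) list" where
  "suffix_snf \<mu> [] = []"
| "suffix_snf \<mu> ((a, d) # w) =
     (let m = (case \<mu> d of Some m \<Rightarrow> m | None \<Rightarrow> (LEAST m. m \<in> {1..} - ran \<mu>))
      in (a, if \<mu> d = None then Fresh m else Reuse m)
         # suffix_snf (if d \<in> snd ` set w then \<mu>(d \<mapsto> m) else \<mu>(d := None)) w)"

section \<open>First and last positions of a data value\<close>

lemma first_pos:
  assumes "i < length w"
  shows "first_pos w (snd (w ! i)) \<le> i" "snd (w ! first_pos w (snd (w ! i))) = snd (w ! i)"
proof -
  let ?I = "{j. j < length w \<and> snd (w ! j) = snd (w ! i)}"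
  have "finite ?I" "i \<in> ?I" using assms by auto
  then have "Min ?I \<in> ?I" "Min ?I \<le> i" using Min_in[of ?I] Min_le[of ?I i] by blast+
  then show "first_pos w (snd (w ! i)) \<le> i" "snd (w ! first_pos w (snd (w ! i))) = snd (w ! i)"
    unfolding first_pos_def by auto
qed

lemma last_pos:
  assumes "i < length w"
  shows "i \<le> last_pos w (snd (w ! i))" "last_pos w (snd (w ! i)) < length w"
    "snd (w ! last_pos w (snd (w ! i))) = snd (w ! i)"
proof -
  let ?I = "{j. j < length w \<and> snd (w ! j) = snd (w ! i)}"
  have "finite ?I" "i \<in> ?I" using assms by auto
  then have "Max ?I \<in> ?I" "i \<le> Max ?I" using Max_in[of ?I] Max_ge[of ?I i] by blast+
  then show "i \<le> last_pos w (snd (w ! i))" "last_pos w (snd (w ! i)) < length w"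
    "snd (w ! last_pos w (snd (w ! i))) = snd (w ! i)"
    unfolding last_pos_def by auto
qed

lemma in_snd_set_conv_nth: "d \<in> snd ` set w \<longleftrightarrow> (\<exists>i<length w. snd (w ! i) = d)"
  by (force simp: in_set_conv_nth image_iff)

lemma in_snd_set_take_iff:
  assumes "d \<in> snd ` set w"
  shows "d \<in> snd ` set (take i w) \<longleftrightarrow> first_pos w d < i"
proof
  assume "d \<in> snd ` set (take i w)"
  then obtain j where "j < length w" "j < i" "snd (w ! j) = d"
    unfolding in_snd_set_conv_nth by auto
  then show "first_pos w d < i" using first_pos(1)[of j w] by auto
next
  obtain j where j: "j < length w" "snd (w ! j) = d"
    using assms unfolding in_snd_set_conv_nth by auto
  assume "first_pos w d < i"
  then show "d \<in> snd ` set (take i w)"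
    using first_pos[OF j(1)] j unfolding in_snd_set_conv_nth
    by (intro exI[of _ "first_pos w d"]) auto
qed

lemma in_snd_set_drop_iff:
  assumes "d \<in> snd ` set w"
  shows "d \<in> snd ` set (drop i w) \<longleftrightarrow> i \<le> last_pos w d"
proof
  assume "d \<in> snd ` set (drop i w)"
  then obtain j where "j < length (drop i w)" "snd (drop i w ! j) = d"
    unfolding in_snd_set_conv_nth by blast
  then have "i + j < length w" "snd (w ! (i + j)) = d" by auto
  then show "i \<le> last_pos w d" using last_pos(1)[of "i + j" w] by auto
next
  obtain j where j: "j < length w" "snd (w ! j) = d"
    using assms unfolding in_snd_set_conv_nth by auto
  assume "i \<le> last_pos w d"
  then show "d \<in> snd ` set (drop i w)"
    using last_pos[OF j(1)] j unfolding in_snd_set_conv_nth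
    by (intro exI[of _ "last_pos w d - i"]) auto
qed

section \<open>The normal form read off at a single position\<close>

definition free_regs :: "('a, 'd) data_word \<Rightarrow> nat \<Rightarrow> nat set" where
  "free_regs w i = snd (snf_prefix w i)"

definition snf_action :: "('a, 'd) data_word \<Rightarrow> nat \<Rightarrow> nat action" where
  "snf_action w i = fst (snf_prefix w (Suc i)) ! i"

definition data_reg :: "('a, 'd) data_word \<Rightarrow> 'd \<Rightarrow> nat" where
  "data_reg w d = reg (snf_action w (first_pos w d))"

lemma length_snf_prefix: "length (fst (snf_prefix w i)) = i"
  by (induction i) (simp_all add: Let_def case_prod_unfold)

lemma snf_prefix_eq_map: "fst (snf_prefix w i) = map (snf_action w) [0..<i]"
proof (induction i)
  case (Suc i)
  obtain \<pi> where "fst (snf_prefix w (Suc i)) = fst (snf_prefix w i) @ [\<pi>]"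
    by (simp add: Let_def case_prod_unfold)
  moreover from this have "snf_action w i = \<pi>"
    by (simp add: snf_action_def nth_append length_snf_prefix del: snf_prefix.simps)
  ultimately show ?case using Suc.IH by simp
qed simp

lemma snf_action_eq:
  assumes "i < length w"
  shows "snf_action w i = (if i = first_pos w (snd (w ! i)) then Fresh (LEAST m. m \<in> free_regs w i)
           else Reuse (data_reg w (snd (w ! i))))"
proof -
  let ?f = "first_pos w (snd (w ! i))"
  have *: "fst (snf_prefix w i) ! ?f = snf_action w ?f" if "?f \<noteq> i"
    using first_pos[OF assms] that unfolding snf_prefix_eq_map by simp
  have "snf_action w i = (if i = ?f then Fresh (LEAST m. m \<in> free_regs w i)
           else Reuse (reg (fst (snf_prefix w i) ! ?f)))"
    unfolding snf_action_def free_regs_def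
    by (simp add: nth_append length_snf_prefix Let_def case_prod_unfold)
  with * show ?thesis by (simp add: data_reg_def)
qed

lemma reg_snf_action:
  assumes "i < length w"
  shows "reg (snf_action w i) = data_reg w (snd (w ! i))"
proof (cases "i = first_pos w (snd (w ! i))")
  case True
  then show ?thesis unfolding data_reg_def by simp
qed (simp add: snf_action_eq[OF assms])

text \<open>At a first position the least free name is exactly the \<open>data_reg\<close> of the
  value, so the same name can be used in every branch of the recursion.\<close>

lemma free_regs_Suc:
  assumes "i < length w" and d: "d = snd (w ! i)"
  shows "free_regs w (Suc i) =
    (if i = first_pos w d \<and> i \<noteq> last_pos w d then free_regs w i - {data_reg w d}
     else if i = last_pos w d then insert (data_reg w d) (free_regs w i)
     else free_regs w i)"
proof -
  let ?f = "first_pos w d"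
  have *: "fst (snf_prefix w i) ! ?f = snf_action w ?f" if "?f \<noteq> i"
    using first_pos[OF assms(1)] that unfolding snf_prefix_eq_map d by simp
  have "free_regs w (Suc i) =
    (if i = first_pos w d \<and> i \<noteq> last_pos w d then free_regs w i - {LEAST m. m \<in> free_regs w i}
     else if i = last_pos w d then insert (if i = ?f then LEAST m. m \<in> free_regs w i
         else reg (fst (snf_prefix w i) ! ?f)) (free_regs w i)
     else free_regs w i)"
    unfolding free_regs_def by (simp add: Let_def case_prod_unfold d)
  moreover have "i = ?f \<Longrightarrow> data_reg w d = (LEAST m. m \<in> free_regs w i)"
    using reg_snf_action[OF assms(1)] snf_action_eq[OF assms(1)] unfolding d by simp
  ultimately show ?thesis using * by (auto simp: data_reg_def)
qed

text \<open>The value of the parameter \<open>\<mu>\<close> of \<open>suffix_snf\<close> once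
  \<open>i\<close> letters have been read; it links the recursion on suffixes to the recursion on
  positions.\<close>

definition live_regs :: "('a, 'd) data_word \<Rightarrow> nat \<Rightarrow> 'd \<rightharpoonup> nat" where
  "live_regs w i = (\<lambda>d. if d \<in> snd ` set (take i w) \<inter> snd ` set (drop i w)
                        then Some (data_reg w d) else None)"


lemma live_regs_Suc:
  assumes "i < length w" and d: "d = snd (w ! i)"
  shows "live_regs w (Suc i) =
    (if d \<in> snd ` set (drop (Suc i) w) then (live_regs w i)(d \<mapsto> data_reg w d)
     else (live_regs w i)(d := None))"
proof -
  have "set (take (Suc i) w) = insert (w ! i) (set (take i w))"
    using assms by (simp add: take_Suc_conv_app_nth)
  moreover have "set (drop i w) = insert (w ! i) (set (drop (Suc i) w))"
    using assms by (metis Cons_nth_drop_Suc list.simps(15))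
  ultimately show ?thesis unfolding live_regs_def d by (auto simp: fun_eq_iff)
qed

text \<open>The value at position \<open>i\<close> always occurs in \<open>drop i w\<close>, so it
  is live as soon as it has been seen before.\<close>

lemma live_regs_nth:
  assumes "i < length w" and d: "d = snd (w ! i)"
  shows "live_regs w i d = (if i = first_pos w d then None else Some (data_reg w d))"
proof -
  have "d \<in> snd ` set w" "d \<in> snd ` set (drop i w)"
    using assms by (auto simp: in_snd_set_conv_nth intro: exI[of _ 0])
  then show ?thesis
    using in_snd_set_take_iff[of d w i] first_pos(1)[OF assms(1)] unfolding live_regs_def d by auto
qed

lemma finite_ran_live_regs: "finite (ran (live_regs w i))"
proof -
  have "ran (live_regs w i) \<subseteq> data_reg w ` snd ` set w"
    unfolding live_regs_def ran_def by (auto split: if_splits dest: in_set_takeD)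
  then show ?thesis by (rule finite_subset) simp
qed

text \<open>Guarantees that each \<open>LEAST\<close> over the free names ranges over a non-empty
  set.\<close>

lemma ex_positive_notin:
  assumes "finite R"
  shows "\<exists>m :: nat. m \<in> {1..} - R"
proof -
  have "infinite ({1..} - R)" by (rule Diff_infinite_finite[OF assms infinite_Ici])
  then show ?thesis using infinite_imp_nonempty by blast
qed

text \<open>The three claims support each other in the induction: a new name is taken outside the
  range, which preserves injectivity, and injectivity makes the end of a session release exactly one
  name.\<close>

lemma free_regs_eq:
  assumes "i \<le> length w"
  shows "free_regs w i = {1..} - ran (live_regs w i) \<and> ran (live_regs w i) \<subseteq> {1..} \<and>
    inj_on (live_regs w i) (dom (live_regs w i))"
  using assms
proof (induction i)
  case 0
  show ?case by (simp add: free_regs_def live_regs_def)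
next
  case (Suc i)
  define d where "d = snd (w ! i)"
  let ?\<mu> = "live_regs w i"
  have i: "i < length w" using Suc.prems by simp
  have IH: "free_regs w i = {1..} - ran ?\<mu>" "ran ?\<mu> \<subseteq> {1..}" "inj_on ?\<mu> (dom ?\<mu>)"
    using Suc by auto
  have dw: "d \<in> snd ` set w" using i by (auto simp: d_def)
  have last: "i \<le> last_pos w d" using last_pos[OF i] by (simp add: d_def)
  have fresh: "data_reg w d \<in> {1..} - ran ?\<mu>" if "i = first_pos w d"
  proof -
    have "data_reg w d = (LEAST m. m \<in> {1..} - ran ?\<mu>)"
      using reg_snf_action[OF i] snf_action_eq[OF i] that IH(1) unfolding d_def by simp
    moreover have "\<exists>m. m \<in> {1..} - ran ?\<mu>" by (rule ex_positive_notin[OF finite_ran_live_regs])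
    ultimately show ?thesis by (metis (no_types, lifting) LeastI_ex)
  qed
  note \<mu>d = live_regs_nth[OF i d_def]
  note \<mu>' = live_regs_Suc[OF i d_def]
  note F' = free_regs_Suc[OF i d_def]
  have dr: "d \<in> snd ` set (drop (Suc i) w) \<longleftrightarrow> i \<noteq> last_pos w d"
    using in_snd_set_drop_iff[OF dw, of "Suc i"] last by auto
  consider "i = first_pos w d" "i \<noteq> last_pos w d" | "i = first_pos w d" "i = last_pos w d" |
    "i \<noteq> first_pos w d" "i \<noteq> last_pos w d" | "i \<noteq> first_pos w d" "i = last_pos w d" by blast
  then show ?case
  proof cases
    case 1
    then have *: "live_regs w (Suc i) = ?\<mu>(d \<mapsto> data_reg w d)"
      "free_regs w (Suc i) = free_regs w i - {data_reg w d}" "?\<mu> d = None"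
      using \<mu>' F' \<mu>d dr by auto
    then have "ran (live_regs w (Suc i)) = insert (data_reg w d) (ran ?\<mu>)"
      "dom (live_regs w (Suc i)) = insert d (dom ?\<mu>)" by simp_all
    moreover have "inj_on (live_regs w (Suc i)) (insert d (dom ?\<mu>))"
      using IH(3) fresh[OF 1(1)] unfolding *(1) by (auto simp: inj_on_def ran_def dom_def)
    moreover have "free_regs w (Suc i) = {1..} - insert (data_reg w d) (ran ?\<mu>)"
      using IH(1) *(2) by blast
    ultimately show ?thesis using IH(2) fresh[OF 1(1)] by auto
  next
    \<comment> \<open>A session of one letter: its name was never taken out of the free set, so
      inserting it changes nothing.\<close>
    case 2
    then have "live_regs w (Suc i) = ?\<mu>" "free_regs w (Suc i) = free_regs w i"
      using \<mu>' F' \<mu>d dr fresh[OF 2(1)] IH(1) by (auto simp: fun_upd_idem)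
    then show ?thesis using IH by simp
  next
    case 3
    then have "live_regs w (Suc i) = ?\<mu>" "free_regs w (Suc i) = free_regs w i"
      using \<mu>' F' \<mu>d dr by (auto simp: fun_upd_idem)
    then show ?thesis using IH by simp
  next
    case 4
    then have *: "live_regs w (Suc i) = ?\<mu>(d := None)"
      "free_regs w (Suc i) = insert (data_reg w d) (free_regs w i)" "?\<mu> d = Some (data_reg w d)"
      using \<mu>' F' \<mu>d dr by auto
    have r: "data_reg w d \<in> ran ?\<mu>" using *(3) by (rule ranI)
    \<comment> \<open>By injectivity no other live value shares the name of \<open>d\<close>, so
      removing \<open>d\<close> from the map removes that name from the range.\<close>
    have ran': "ran (live_regs w (Suc i)) = ran ?\<mu> - {data_reg w d}"
      using IH(3) *(3) unfolding *(1) by (auto simp: ran_def inj_on_def dom_def) (metis option.inject)+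
    have "inj_on (live_regs w (Suc i)) (dom (live_regs w (Suc i)))"
      using IH(3) unfolding *(1) by (simp add: inj_on_def)
    moreover have "free_regs w (Suc i) = {1..} - ran (live_regs w (Suc i))"
      unfolding *(2) ran' IH(1) using r IH(2) by blast
    moreover have "ran (live_regs w (Suc i)) \<subseteq> {1..}" unfolding ran' using IH(2) by blast
    ultimately show ?thesis by blast
  qed
qed

text \<open>\<open>suffix_snf\<close> consumes the word from the front, so the induction descends
  from \<open>i = length w\<close>; the instance \<open>i = 0\<close> is the one wanted.\<close>

lemma suffix_snf_live_regs:
  assumes "i \<le> length w"
  shows "suffix_snf (live_regs w i) (drop i w) = zip (map fst (drop i w)) (map (snf_action w) [i..<length w])"
  using assms
proof (induction i rule: inc_induct)
  case (step i)
  obtain a d where ad: "w ! i = (a, d)" by fastforce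
  then have d: "d = snd (w ! i)" by simp
  have m: "(case live_regs w i d of Some m \<Rightarrow> m | None \<Rightarrow> (LEAST m. m \<in> {1..} - ran (live_regs w i)))
      = data_reg w d"
    using live_regs_nth[OF step(2) d] reg_snf_action[OF step(2)] snf_action_eq[OF step(2)]
      free_regs_eq[of i w] step(2) by (auto split: if_splits simp flip: d)
  have \<pi>: "snf_action w i = (if live_regs w i d = None then Fresh (data_reg w d)
        else Reuse (data_reg w d))"
    using live_regs_nth[OF step(2) d] reg_snf_action[OF step(2)] snf_action_eq[OF step(2)]
    by (auto split: if_splits simp flip: d)
  have "drop i w = (a, d) # drop (Suc i) w"
    using step(2) by (simp add: Cons_nth_drop_Suc flip: ad)
  moreover have "[i..<length w] = i # [Suc i..<length w]" using step(2) by (simp add: upt_conv_Cons)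
  ultimately show ?case
    using step.IH unfolding live_regs_Suc[OF step(2) d]
    by (simp only: suffix_snf.simps m Let_def list.map zip_Cons_Cons fst_conv \<pi>)
qed simp

lemma snf_eq_suffix_snf: "snf w = suffix_snf Map.empty w"
  using suffix_snf_live_regs[of 0 w] by (simp add: snf_def snf_prefix_eq_map live_regs_def)

section \<open>Session automata keep live data in registers\<close>

text \<open>A value in \<open>U\<close> can only be read again by a reuse, so some register must
  hold it at that moment. Steps reading other values never put it into a register, so it must
  already be there now.\<close>

lemma run_seen_in_registers:
  assumes "run A (s, \<tau>, U) w c" "d \<in> U" "d \<in> snd ` set w"
  shows "d \<in> ran \<tau>"
  using assms
proof (induction "(s, \<tau>, U)" w c arbitrary: s \<tau> U rule: run.induct)
  case (run_Cons s a \<pi> s' \<tau> U d' w c)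
  show ?case
  proof (cases "d = d'")
    case True
    then show ?thesis using run_Cons by (cases \<pi>) (auto intro: ranI)
  next
    case False
    then have "d \<in> ran (\<tau>(reg \<pi> \<mapsto> d'))" using run_Cons by auto
    then show ?thesis using False by (auto simp: ran_def split: if_splits)
  qed
qed simp

definition reg_inv :: "'r set \<Rightarrow> ('r \<rightharpoonup> 'd) \<Rightarrow> 'd set \<Rightarrow> bool" where
  "reg_inv R \<tau> U \<longleftrightarrow> dom \<tau> \<subseteq> R \<and> ran \<tau> \<subseteq> U \<and> inj_on \<tau> (dom \<tau>)"

lemma reg_invD: "reg_inv R \<tau> U \<Longrightarrow> \<tau> r = Some d \<Longrightarrow> \<tau> r' = Some d \<Longrightarrow> r = r'"
  unfolding reg_inv_def inj_on_def by (metis domI)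

text \<open>A fresh value lies outside \<open>U\<close>, hence outside \<open>ran \<tau>\<close>,
  and cannot create a duplicate; a reuse writes back what the register already holds.\<close>

lemma reg_inv_step:
  assumes "reg_inv R \<tau> U" "enabled \<tau> U d \<pi>" "\<pi> \<in> actions R"
  shows "reg_inv R (\<tau>(reg \<pi> \<mapsto> d)) (insert d U)"
proof (cases \<pi>)
  case (Fresh r)
  with assms have "r \<in> R" "d \<notin> ran \<tau>" by (auto simp: actions_def reg_inv_def)
  with assms(1) show ?thesis
    unfolding reg_inv_def Fresh by (auto simp: inj_on_def ran_def split: if_splits)
next
  case (Reuse r)
  with assms(2) have "\<tau>(reg \<pi> \<mapsto> d) = \<tau>" by auto
  with assms(1) show ?thesis unfolding reg_inv_def by auto
qed

text \<open>The last conjunct serves sessions that end exactly at the cut: their value does not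
  recur in \<open>v\<close>, so \<open>run_seen_in_registers\<close> says nothing about it.\<close>

lemma run_prefix:
  assumes "run A (s, \<tau>, U) (u @ v) c" "is_session_automaton \<Sigma> A" "reg_inv (registers A) \<tau> U"
  shows "\<exists>s' \<tau>'. run A (s', \<tau>', U \<union> snd ` set u) v c \<and> reg_inv (registers A) \<tau>' (U \<union> snd ` set u) \<and>
    (u \<noteq> [] \<longrightarrow> snd (last u) \<in> ran \<tau>')"
  using assms(1,3)
proof (induction u arbitrary: s \<tau> U)
  case (Cons x u)
  from Cons.prems(1) obtain a d \<pi> s' where x: "x = (a, d)"
    and tr: "(s, (a, \<pi>), s') \<in> transitions A" "enabled \<tau> U d \<pi>"
    and r: "run A (s', \<tau>(reg \<pi> \<mapsto> d), insert d U) (u @ v) c"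
    by (auto elim: run.cases)
  have "\<pi> \<in> actions (registers A)" using tr(1) assms(2) by (auto simp: is_session_automaton_def)
  from reg_inv_step[OF Cons.prems(2) tr(2) this]
  have "reg_inv (registers A) (\<tau>(reg \<pi> \<mapsto> d)) (insert d U)" .
  from Cons.IH[OF r this] obtain s2 \<tau>2 where IH: "run A (s2, \<tau>2, insert d U \<union> snd ` set u) v c"
    "reg_inv (registers A) \<tau>2 (insert d U \<union> snd ` set u)" "u \<noteq> [] \<longrightarrow> snd (last u) \<in> ran \<tau>2"
    by blast
  show ?case
  proof (cases "u = []")
    case True
    have "d \<in> ran (\<tau>(reg \<pi> \<mapsto> d))" by (auto simp: ran_def)
    then show ?thesis
      using r \<open>reg_inv (registers A) (\<tau>(reg \<pi> \<mapsto> d)) (insert d U)\<close> True x by auto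
  next
    case False
    have "U \<union> snd ` set (x # u) = insert d U \<union> snd ` set u" by (simp add: x)
    then show ?thesis using IH False by (metis last_ConsR)
  qed
qed auto

lemma reg_inv_empty: "reg_inv R Map.empty {}"
  by (simp add: reg_inv_def)

lemma sa_language_bounded:
  assumes "is_session_automaton \<Sigma> A" "registers A = {1..k}"
  shows "bounded_language k (sa_language \<Sigma> D A)"
  unfolding bounded_language_def bounded_word_def
proof (intro ballI allI impI)
  fix w i assume "w \<in> sa_language \<Sigma> D A" and i: "i < length w"
  then obtain c where "run A (initial A, Map.empty, {}) w c"
    unfolding sa_language_def by auto
  \<comment> \<open>The cut is made after position \<open>i\<close>, so that the value read at
    \<open>i\<close> has just been written to a register.\<close>
  then have "run A (initial A, Map.empty, {}) (take (Suc i) w @ drop (Suc i) w) c" by simp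
  from run_prefix[OF this assms(1) reg_inv_empty]
  obtain s \<tau> where r: "run A (s, \<tau>, snd ` set (take (Suc i) w)) (drop (Suc i) w) c"
    and inv: "reg_inv {1..k} \<tau> (snd ` set (take (Suc i) w))"
    and last: "snd (last (take (Suc i) w)) \<in> ran \<tau>"
    using i assms(2) by fastforce
  \<comment> \<open>A session around \<open>i\<close> belongs to a value already seen. Either the
    value recurs and is held for that purpose, or it is the one read at \<open>i\<close>.\<close>
  have "{I \<in> sessions w. i \<in> I} \<subseteq> (\<lambda>d. {first_pos w d..last_pos w d}) ` ran \<tau>"
  proof
    fix I assume "I \<in> {I \<in> sessions w. i \<in> I}"
    then obtain d where d: "d \<in> snd ` set w" "I = {first_pos w d..last_pos w d}"
      "first_pos w d \<le> i" "i \<le> last_pos w d"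
      unfolding sessions_def by force
    have seen: "d \<in> snd ` set (take (Suc i) w)" using d in_snd_set_take_iff by fastforce
    have "d \<in> ran \<tau>"
    proof (cases "d \<in> snd ` set (drop (Suc i) w)")
      case True
      then show ?thesis using run_seen_in_registers[OF r seen] by simp
    next
      case False
      then have "last_pos w d = i" using in_snd_set_drop_iff[OF d(1)] d(4) by fastforce
      then have "snd (w ! i) = d" using d(1) last_pos(3) unfolding in_snd_set_conv_nth by metis
      then show ?thesis using last i by (simp add: take_Suc_conv_app_nth)
    qed
    then show "I \<in> (\<lambda>d. {first_pos w d..last_pos w d}) ` ran \<tau>" using d(2) by blast
  qed
  moreover have "finite (dom \<tau>)" "card (dom \<tau>) \<le> k"
    using inv finite_subset[of "dom \<tau>" "{1..k}"] card_mono[of "{1..k}" "dom \<tau>"]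
    by (auto simp: reg_inv_def)
  moreover have "ran \<tau> = (the \<circ> \<tau>) ` dom \<tau>" by (force simp: ran_def)
  ultimately show "card {I \<in> sessions w. i \<in> I} \<le> k"
    by (metis (no_types, lifting) card_image_le card_mono finite_imageI le_trans)
qed

section \<open>The automaton for the symbolic normal forms\<close>

text \<open>A state \<open>(s, R)\<close> consists of a state of the session automaton and of the set of pairs \<open>(m, r)\<close>
  such that the register \<open>r\<close> holds a live value whose name in the normal form is \<open>m\<close>. Whether the
  current letter is the last one of its session is guessed.\<close>

fun snf_step :: "nat \<Rightarrow> (nat \<times> nat) set \<Rightarrow> nat action \<Rightarrow> nat action \<Rightarrow> (nat \<times> nat) set \<Rightarrow> bool" where
  "snf_step k R (Fresh r) (Fresh m) R' \<longleftrightarrow>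
     m \<in> {1..k} - Domain R \<and> {1..<m} \<subseteq> Domain R \<and> r \<notin> Range R \<and> (R' = R \<or> R' = insert (m, r) R)"
| "snf_step k R (Reuse r) (Reuse m) R' \<longleftrightarrow> (m, r) \<in> R \<and> (R' = R \<or> R' = R - {(m, r)})"
| "snf_step k R _ _ R' \<longleftrightarrow> False"

text \<open>The action \<open>\<alpha>\<close> on registers is projected away: the letter shows only
  the name, so the register is chosen nondeterministically along with the transition of
  \<open>A\<close>.\<close>

definition snf_nfa :: "nat \<Rightarrow> ('s, 'a, nat) session_automaton \<Rightarrow>
    ('s \<times> (nat \<times> nat) set, 'a \<times> nat action) nfa" where
  "snf_nfa k A = \<lparr>
     nfa_states = states A \<times> Pow ({1..k} \<times> {1..k}),
     nfa_initial = (initial A, {}),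
     nfa_final = final A \<times> {{}},
     nfa_trans = {((s, R), (a, \<pi>), (s', R')) | s R a \<pi> s' R' \<alpha>.
       (s, (a, \<alpha>), s') \<in> transitions A \<and> R \<subseteq> {1..k} \<times> {1..k} \<and> R' \<subseteq> {1..k} \<times> {1..k} \<and> snf_step k R \<alpha> \<pi> R'}\<rparr>"

section \<open>Names and registers related through the data values\<close>

definition live_rel :: "('d \<rightharpoonup> nat) \<Rightarrow> (nat \<rightharpoonup> 'd) \<Rightarrow> (nat \<times> nat) set" where
  "live_rel \<mu> \<tau> = {(m, r). \<exists>d. \<mu> d = Some m \<and> \<tau> r = Some d}"

lemma Domain_live_rel: "dom \<mu> \<subseteq> ran \<tau> \<Longrightarrow> Domain (live_rel \<mu> \<tau>) = ran \<mu>"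
  unfolding live_rel_def ran_def dom_def by blast

lemma live_rel_empty [simp]: "live_rel Map.empty \<tau> = {}"
  by (simp add: live_rel_def)

lemma live_rel_iff: "(m, r) \<in> live_rel \<mu> \<tau> \<longleftrightarrow> (\<exists>d. \<mu> d = Some m \<and> \<tau> r = Some d)"
  by (simp add: live_rel_def)

text \<open>Since \<open>r\<close> is outside the range of the relation, its old content is dead and
  overwriting it loses no pair. The two equations match the two guesses: the session ends at this
  letter, or it continues.\<close>

lemma live_rel_fresh:
  assumes "d \<notin> dom \<mu>" "d \<notin> ran \<tau>" "r \<notin> Range (live_rel \<mu> \<tau>)"
  shows "live_rel \<mu> (\<tau>(r \<mapsto> d)) = live_rel \<mu> \<tau>" (is ?A)
    and "live_rel (\<mu>(d \<mapsto> m)) (\<tau>(r \<mapsto> d)) = insert (m, r) (live_rel \<mu> \<tau>)" (is ?B)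
proof -
  have r: "\<mu> e = None" if "\<tau> r = Some e" for e
    using assms(3) that unfolding live_rel_def by (cases "\<mu> e") auto
  have d: "\<mu> d = None" "\<tau> r' \<noteq> Some d" for r' using assms(1,2) by (auto intro: ranI)
  have "(n, r') \<in> live_rel \<mu> (\<tau>(r \<mapsto> d)) \<longleftrightarrow> (n, r') \<in> live_rel \<mu> \<tau>" for n r'
    unfolding live_rel_iff using r d by (cases "r' = r") auto
  then show ?A by auto
  have "(\<mu>(d \<mapsto> m)) e = Some n \<and> (\<tau>(r \<mapsto> d)) r' = Some e \<longleftrightarrow>
      e = d \<and> n = m \<and> r' = r \<or> \<mu> e = Some n \<and> \<tau> r' = Some e" for e n r'
    using r d by (cases "e = d"; cases "r' = r") auto
  then have "(n, r') \<in> live_rel (\<mu>(d \<mapsto> m)) (\<tau>(r \<mapsto> d)) \<longleftrightarrow> (n, r') = (m, r) \<or> (n, r') \<in> live_rel \<mu> \<tau>"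
    for n r'
    unfolding live_rel_iff by blast
  then show ?B by auto
qed

text \<open>The invariant makes \<open>r\<close> the only register holding \<open>d\<close>, so
  forgetting \<open>d\<close> deletes a single pair.\<close>

lemma live_rel_remove:
  assumes inv: "reg_inv R \<tau> U" and "\<mu> d = Some m" "\<tau> r = Some d"
  shows "live_rel (\<mu>(d := None)) \<tau> = live_rel \<mu> \<tau> - {(m, r)}"
proof -
  have *: "(\<mu>(d := None)) e = Some n \<and> \<tau> r' = Some e \<longleftrightarrow>
      (\<mu> e = Some n \<and> \<tau> r' = Some e) \<and> (n, r') \<noteq> (m, r)" for e n r'
  proof (cases "e = d")
    case True
    have "\<tau> r' = Some d \<longleftrightarrow> r' = r" using reg_invD[OF inv assms(3)] assms(3) by blast
    then show ?thesis using True assms(2) by auto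
  qed (use assms(3) in auto)
  show ?thesis unfolding live_rel_def * by auto
qed

text \<open>Turns minimality into the condition tested by \<open>snf_step\<close>, which refers only
  to the names in use.\<close>

lemma Least_free_eq_iff:
  fixes \<mu> :: "'d \<rightharpoonup> nat"
  assumes "finite (ran \<mu>)"
  shows "m = (LEAST m. m \<in> {1..} - ran \<mu>) \<longleftrightarrow> m \<in> {1..} - ran \<mu> \<and> {1..<m} \<subseteq> ran \<mu>"
proof
  assume m: "m = (LEAST m. m \<in> {1..} - ran \<mu>)"
  have "i \<in> ran \<mu>" if "i \<in> {1..<m}" for i
    using not_less_Least[of i "\<lambda>m. m \<in> {1..} - ran \<mu>"] that m by auto
  then show "m \<in> {1..} - ran \<mu> \<and> {1..<m} \<subseteq> ran \<mu>"
    using LeastI_ex[OF ex_positive_notin[OF assms]] unfolding m by blast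
next
  assume m: "m \<in> {1..} - ran \<mu> \<and> {1..<m} \<subseteq> ran \<mu>"
  show "m = (LEAST m. m \<in> {1..} - ran \<mu>)"
  proof (rule Least_equality[symmetric])
    fix i assume "i \<in> {1..} - ran \<mu>"
    then show "m \<le> i" using m by (meson Diff_iff atLeastLessThan_iff atLeast_iff not_le subsetD)
  qed (use m in blast)
qed

text \<open>The hypothesis on \<open>dom \<mu>\<close> looks ahead into \<open>w\<close>: live means
  seen and still to come. It fixes every guess and leaves nothing live at the end of the word, which
  yields the empty final relation.\<close>

lemma snf_nfa_complete:
  assumes "run A (s, \<tau>, U) w (s', \<tau>', U')"
    and A: "is_session_automaton \<Sigma> A" "registers A = {1..k}"
    and "reg_inv {1..k} \<tau> U" "dom \<mu> = U \<inter> snd ` set w" "ran \<mu> \<subseteq> {1..k}"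
  shows "nfa_run (snf_nfa k A) (s, live_rel \<mu> \<tau>) (suffix_snf \<mu> w) (s', {})"
  using assms(1,4-)
proof (induction "(s, \<tau>, U)" w "(s', \<tau>', U')" arbitrary: s \<tau> U \<mu> rule: run.induct)
  case run_Nil
  then show ?case by (simp add: nfa_run_Nil)
next
  case (run_Cons s a \<alpha> s1 \<tau> U d w)
  let ?R = "live_rel \<mu> \<tau>" and ?\<tau> = "\<tau>(reg \<alpha> \<mapsto> d)"
  define m where "m = (case \<mu> d of Some m \<Rightarrow> m | None \<Rightarrow> (LEAST m. m \<in> {1..} - ran \<mu>))"
  define \<pi> where "\<pi> = (if \<mu> d = None then Fresh m else Reuse m)"
  define \<mu>' where "\<mu>' = (if d \<in> snd ` set w then \<mu>(d \<mapsto> m) else \<mu>(d := None))"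
  note inv = run_Cons.prems(1)
  have dom\<mu>: "dom \<mu> \<subseteq> ran \<tau>"
    using run_seen_in_registers[OF run.run_Cons[OF run_Cons.hyps(1-3)]] run_Cons.prems(2) by blast
  have \<alpha>: "\<alpha> \<in> actions {1..k}" using run_Cons.hyps(1) A by (auto simp: is_session_automaton_def)
  have inv': "reg_inv {1..k} ?\<tau> (insert d U)" by (rule reg_inv_step[OF inv run_Cons.hyps(2) \<alpha>])
  have fin: "finite (ran \<mu>)" using run_Cons.prems(3) finite_subset by blast
  have dom\<mu>': "dom \<mu>' = insert d U \<inter> snd ` set w"
    using run_Cons.prems(2) unfolding \<mu>'_def by auto
  have Rk: "?R \<subseteq> {1..k} \<times> {1..k}"
    using run_Cons.prems(3) inv unfolding live_rel_def reg_inv_def ran_def dom_def by blast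
  have step: "snf_step k ?R \<alpha> \<pi> (live_rel \<mu>' ?\<tau>) \<and> m \<in> {1..k}"
  proof (cases \<alpha>)
    case (Fresh r)
    then have d: "d \<notin> U" "d \<notin> ran \<tau>" "d \<notin> dom \<mu>" "\<mu> d = None"
      using run_Cons.hyps(2) inv run_Cons.prems(2) by (auto simp: reg_inv_def)
    \<comment> \<open>A live value \<open>d'\<close> in \<open>r\<close> would have to survive the
      overwriting in another register, and so would have been stored twice before the step.\<close>
    have r: "r \<notin> Range ?R"
    proof
      assume "r \<in> Range ?R"
      then obtain d' where d': "d' \<in> dom \<mu>" "\<tau> r = Some d'" unfolding live_rel_def by auto
      then have "d' \<in> U" "d' \<noteq> d" using run_Cons.prems(2) d by auto
      moreover from this have "d' \<in> snd ` set w" using d'(1) run_Cons.prems(2) by auto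
      ultimately have "d' \<in> ran (\<tau>(r \<mapsto> d))"
        using run_seen_in_registers[OF run_Cons.hyps(3)] Fresh by auto
      then obtain r' where "r' \<noteq> r" "\<tau> r' = Some d'" using \<open>d' \<noteq> d\<close>
        by (auto simp: ran_def split: if_splits)
      then show False using reg_invD[OF inv d'(2)] by blast
    qed
    have "m = (LEAST m. m \<in> {1..} - ran \<mu>)" using d by (simp add: m_def)
    then have m: "m \<in> {1..} - Domain ?R" "{1..<m} \<subseteq> Domain ?R"
      unfolding Least_free_eq_iff[OF fin] Domain_live_rel[OF dom\<mu>] by auto
    \<comment> \<open>The \<open>m - 1\<close> smaller names are all in use and their values sit in
      distinct registers different from \<open>r\<close>, so \<open>m - 1 \<le> k - 1\<close>. The
      map \<open>f\<close> recovers a name from the register through its content.\<close>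
    have "m \<le> k"
    proof -
      have "\<exists>f. \<forall>(j, r') \<in> ?R. f r' = j"
        by (rule exI[of _ "\<lambda>r'. the (\<mu> (the (\<tau> r')))"]) (auto simp: live_rel_def)
      then obtain f where "\<forall>(j, r') \<in> ?R. f r' = j" by blast
      then have "{1..<m} \<subseteq> f ` ({1..k} - {r})" using m(2) r Rk by (fastforce simp: image_iff)
      then have "m - 1 \<le> card ({1..k} - {r})"
        by (metis card_atLeastLessThan finite_Diff finite_atLeastAtMost surj_card_le)
      moreover have "r \<in> {1..k}" using \<alpha> Fresh by (auto simp: actions_def)
      ultimately show ?thesis using m(1) by auto
    qed
    then show ?thesis
      using m r d live_rel_fresh[OF d(3,2) r] unfolding Fresh \<pi>_def \<mu>'_def by (auto simp: fun_upd_idem)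
  next
    case (Reuse r)
    then have r: "\<tau> r = Some d" using run_Cons.hyps(2) by simp
    then have "d \<in> U" using inv by (auto simp: reg_inv_def intro: ranI)
    then have d: "\<mu> d = Some m" using run_Cons.prems(2) by (cases "\<mu> d") (auto simp: m_def)
    then have "m \<in> {1..k}" using run_Cons.prems(3) by (auto intro: ranI)
    moreover have "(m, r) \<in> ?R" using d r by (auto simp: live_rel_def)
    moreover have "?\<tau> = \<tau>" using r Reuse by auto
    ultimately show ?thesis
      using d r live_rel_remove[OF inv, of \<mu> d m r] unfolding Reuse \<pi>_def \<mu>'_def by (auto simp: fun_upd_idem)
  qed
  then have ran\<mu>': "ran \<mu>' \<subseteq> {1..k}"
    using run_Cons.prems(3) unfolding \<mu>'_def by (auto simp: ran_def split: if_splits)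
  then have R'k: "live_rel \<mu>' ?\<tau> \<subseteq> {1..k} \<times> {1..k}"
    using inv' unfolding live_rel_def reg_inv_def ran_def dom_def by blast
  have "((s, ?R), (a, \<pi>), (s1, live_rel \<mu>' ?\<tau>)) \<in> nfa_trans (snf_nfa k A)"
    using run_Cons.hyps(1) step Rk R'k by (auto simp: snf_nfa_def)
  from nfa_run_Cons[OF this run_Cons.hyps(4)[OF inv' dom\<mu>' ran\<mu>']]
  show ?case by (simp only: suffix_snf.simps Let_def flip: m_def \<pi>_def \<mu>'_def)
qed

inductive_cases nfa_run_NilE: "nfa_run B q [] q'"
inductive_cases nfa_run_ConsE: "nfa_run B q (x # u) q'"

lemma snf_nfa_sound:
  assumes "nfa_run (snf_nfa k A) (s, live_rel \<mu> \<tau>) u (s', {})"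
    and A: "is_session_automaton \<Sigma> A" "registers A = {1..k}" and D: "infinite D"
    and "reg_inv {1..k} \<tau> U" "finite U" "U \<subseteq> D" "dom \<mu> \<subseteq> ran \<tau>"
  shows "\<exists>w \<tau>' U'. w \<in> lists (\<Sigma> \<times> D) \<and> suffix_snf \<mu> w = u \<and> U \<inter> snd ` set w = dom \<mu> \<and>
    run A (s, \<tau>, U) w (s', \<tau>', U')"
  using assms(1,5-)
proof (induction u arbitrary: s \<mu> \<tau> U)
  case Nil
  from Nil(1) have s: "s = s'" "live_rel \<mu> \<tau> = {}" by (auto elim: nfa_run_NilE)
  \<comment> \<open>Every live value sits in a register and would contribute a pair, so an empty
    relation leaves no live value.\<close>
  then have "dom \<mu> = {}" using Nil.prems(5) by (fastforce simp: live_rel_def ran_def)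
  with s show ?case by (intro exI[of _ "[]"]) (auto intro: run_Nil)
next
  case (Cons x u)
  let ?R = "live_rel \<mu> \<tau>"
  note inv = Cons.prems(2)
  from Cons.prems(1) obtain q where "((s, ?R), x, q) \<in> nfa_trans (snf_nfa k A)"
    "nfa_run (snf_nfa k A) q u (s', {})" by (rule nfa_run_ConsE)
  then obtain a \<pi> \<alpha> s1 R' where x: "x = (a, \<pi>)" and tr: "(s, (a, \<alpha>), s1) \<in> transitions A"
    and step: "snf_step k ?R \<alpha> \<pi> R'" and r: "nfa_run (snf_nfa k A) (s1, R') u (s', {})"
    unfolding snf_nfa_def by auto
  have a: "a \<in> \<Sigma>" and \<alpha>: "\<alpha> \<in> actions {1..k}" using tr A by (auto simp: is_session_automaton_def)
  have "finite (ran \<mu>)"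
  proof -
    have "finite (dom \<mu>)" using Cons.prems inv finite_subset unfolding reg_inv_def by metis
    then show ?thesis by (rule finite_ran)
  qed
  note least = Least_free_eq_iff[OF this]
  show ?case
  proof (cases \<alpha>)
    case (Fresh r)
    with step obtain m where \<pi>: "\<pi> = Fresh m" and m: "m \<in> {1..k} - Domain ?R" "{1..<m} \<subseteq> Domain ?R"
      and rR: "r \<notin> Range ?R" and R': "R' = ?R \<or> R' = insert (m, r) ?R"
      by (cases \<pi>) auto
    have "infinite (D - U)" by (rule Diff_infinite_finite[OF Cons.prems(3) D])
    then obtain d where d: "d \<in> D" "d \<notin> U" using infinite_imp_nonempty by blast
    have d': "d \<notin> ran \<tau>" "d \<notin> dom \<mu>" using d inv Cons.prems(5) by (auto simp: reg_inv_def)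
    \<comment> \<open>The choice of \<open>R'\<close> is the guess: an unchanged relation means that
      the new value does not recur. The cases exclude each other because \<open>m\<close> is outside
      the domain of the old relation.\<close>
    define \<mu>' where "\<mu>' = (if R' = ?R then \<mu> else \<mu>(d \<mapsto> m))"
    have least': "(LEAST m. m \<in> {1..} - ran \<mu>) = m"
      using m unfolding Domain_live_rel[OF Cons.prems(5)] by (intro least[THEN iffD2, symmetric]) auto
    have en: "enabled \<tau> U d \<alpha>" using d by (simp add: Fresh)
    have inv': "reg_inv {1..k} (\<tau>(r \<mapsto> d)) (insert d U)"
      using reg_inv_step[OF inv en \<alpha>] by (simp add: Fresh)
    have rel: "R' = live_rel \<mu>' (\<tau>(r \<mapsto> d))"
      using R' live_rel_fresh[OF d'(2,1) rR] unfolding \<mu>'_def by auto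
    have "dom \<mu> \<subseteq> ran (\<tau>(r \<mapsto> d))"
    proof
      fix e assume "e \<in> dom \<mu>"
      moreover from this obtain r' where "\<tau> r' = Some e" using Cons.prems(5) by (auto simp: ran_def)
      ultimately have "r' \<noteq> r" "\<tau> r' = Some e" using rR by (auto simp: live_rel_def)
      then show "e \<in> ran (\<tau>(r \<mapsto> d))" by (auto simp: ran_def)
    qed
    then have "dom \<mu>' \<subseteq> ran (\<tau>(r \<mapsto> d))" unfolding \<mu>'_def by (auto simp: ran_def)
    moreover have "finite (insert d U)" "insert d U \<subseteq> D" using Cons.prems(3,4) d(1) by auto
    ultimately have "\<exists>w \<tau>' U'. w \<in> lists (\<Sigma> \<times> D) \<and> suffix_snf \<mu>' w = u \<and>
        insert d U \<inter> snd ` set w = dom \<mu>' \<and> run A (s1, \<tau>(r \<mapsto> d), insert d U) w (s', \<tau>', U')"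
      using Cons.IH[OF r[unfolded rel] inv'] by blast
    then
    obtain w \<tau>' U' where w: "w \<in> lists (\<Sigma> \<times> D)" "suffix_snf \<mu>' w = u"
      "insert d U \<inter> snd ` set w = dom \<mu>'" "run A (s1, \<tau>(r \<mapsto> d), insert d U) w (s', \<tau>', U')"
      by blast
    \<comment> \<open>The certificate for the rest of the word confirms the guess, so the look-ahead
      of \<open>suffix_snf\<close> takes the branch that produced \<open>\<mu>'\<close>.\<close>
    have "d \<in> snd ` set w \<longleftrightarrow> d \<in> dom \<mu>'" using w(3) by auto
    then have eq: "(if d \<in> snd ` set w then \<mu>(d \<mapsto> m) else \<mu>(d := None)) = \<mu>'"
      using d'(2) unfolding \<mu>'_def by (cases "R' = ?R") (simp_all add: fun_upd_idem domIff)
    have "\<mu> d = None" using d' by auto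
    then have "suffix_snf \<mu> ((a, d) # w) = x # u"
      using w(2) by (simp only: suffix_snf.simps Let_def option.simps simp_thms if_True least' eq x \<pi>)
    moreover have "U \<inter> snd ` set ((a, d) # w) = dom \<mu>"
    proof -
      have "U \<inter> snd ` set ((a, d) # w) = dom \<mu>' - {d}" using d(2) w(3) by auto
      also have "\<dots> = dom \<mu>" using d' unfolding \<mu>'_def by auto
      finally show ?thesis .
    qed
    moreover have "run A (s, \<tau>, U) ((a, d) # w) (s', \<tau>', U')"
      using w(4) by (intro run_Cons[OF tr en]) (simp add: Fresh)
    ultimately show ?thesis using w(1) a d(1)
      by (intro exI[of _ "(a, d) # w"] exI[of _ \<tau>'] exI[of _ U']) simp
  next
    case (Reuse r)
    with step obtain m where \<pi>: "\<pi> = Reuse m" and mr: "(m, r) \<in> ?R" and R': "R' = ?R \<or> R' = ?R - {(m, r)}"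
      by (cases \<pi>) auto
    from mr obtain d where d: "\<mu> d = Some m" "\<tau> r = Some d" by (auto simp: live_rel_def)
    have dU: "d \<in> U" using d(2) inv by (auto simp: reg_inv_def intro: ranI)
    have en: "enabled \<tau> U d \<alpha>" using d by (simp add: Reuse)
    define \<mu>' where "\<mu>' = (if R' = ?R then \<mu> else \<mu>(d := None))"
    have rel: "R' = live_rel \<mu>' \<tau>"
      using R' d live_rel_remove[OF inv, of \<mu> d m r] unfolding \<mu>'_def by auto
    have "dom \<mu>' \<subseteq> ran \<tau>" using Cons.prems(5) unfolding \<mu>'_def by auto
    from Cons.IH[OF r[unfolded rel] inv Cons.prems(3,4) this]
    obtain w \<tau>' U' where w: "w \<in> lists (\<Sigma> \<times> D)" "suffix_snf \<mu>' w = u"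
      "U \<inter> snd ` set w = dom \<mu>'" "run A (s1, \<tau>, U) w (s', \<tau>', U')"
      by blast
    have "d \<in> snd ` set w \<longleftrightarrow> d \<in> dom \<mu>'" using w(3) dU by auto
    then have eq: "(if d \<in> snd ` set w then \<mu>(d \<mapsto> m) else \<mu>(d := None)) = \<mu>'"
      using d unfolding \<mu>'_def by (cases "R' = ?R") (simp_all add: fun_upd_idem domIff)
    have "suffix_snf \<mu> ((a, d) # w) = x # u"
      using w(2) by (simp only: suffix_snf.simps Let_def option.simps simp_thms if_False d eq x \<pi>)
    moreover have "U \<inter> snd ` set ((a, d) # w) = dom \<mu>"
    proof -
      have "U \<inter> snd ` set ((a, d) # w) = insert d (dom \<mu>')" using dU w(3) by auto
      also have "\<dots> = dom \<mu>" using d unfolding \<mu>'_def by auto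
      finally show ?thesis .
    qed
    moreover have "run A (s, \<tau>, U) ((a, d) # w) (s', \<tau>', U')"
      using w(4) d dU by (intro run_Cons[OF tr en]) (simp add: Reuse fun_upd_idem insert_absorb)
    moreover have "d \<in> D" using dU Cons.prems(4) by blast
    ultimately show ?thesis using w(1) a
      by (intro exI[of _ "(a, d) # w"] exI[of _ \<tau>'] exI[of _ U']) simp
  qed
qed

lemma nfa_language_snf_nfa:
  fixes D :: "'d set"
  assumes "is_session_automaton \<Sigma> A" "registers A = {1..k}" "infinite D"
  shows "nfa_language (snf_nfa k A) = snf ` sa_language \<Sigma> D A"
proof (intro equalityI subsetI)
  fix u assume "u \<in> nfa_language (snf_nfa k A)"
  then obtain s where "s \<in> final A" and
    "nfa_run (snf_nfa k A) (initial A, live_rel Map.empty (Map.empty :: nat \<rightharpoonup> 'd)) u (s, {})"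
    unfolding nfa_language_def by (auto simp: snf_nfa_def)
  with snf_nfa_sound[OF this(2) assms reg_inv_empty]
  obtain w \<tau> U where "w \<in> lists (\<Sigma> \<times> D)" "suffix_snf Map.empty w = u"
    "run A (initial A, Map.empty, {}) w (s, \<tau>, U)" "s \<in> final A"
    by auto
  then show "u \<in> snf ` sa_language \<Sigma> D A"
    unfolding sa_language_def snf_eq_suffix_snf by blast
next
  fix u assume "u \<in> snf ` sa_language \<Sigma> D A"
  then obtain w where "u = snf w" "w \<in> sa_language \<Sigma> D A" by blast
  then obtain s \<tau> U where "u = suffix_snf Map.empty w" "s \<in> final A"
    "run A (initial A, Map.empty, {}) w (s, \<tau>, U)"
    unfolding sa_language_def snf_eq_suffix_snf by blast
  with snf_nfa_complete[OF this(3) assms(1,2) reg_inv_empty, of Map.empty]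
  show "u \<in> nfa_language (snf_nfa k A)"
    unfolding nfa_language_def by (auto simp: snf_nfa_def)
qed

section \<open>Renaming the states of a finite automaton\<close>

text \<open>Both \<open>regular\<close> and \<open>nfa_code\<close> require states that are natural
  numbers.\<close>

definition nfa_map :: "('q \<Rightarrow> 'p) \<Rightarrow> ('q, 'l) nfa \<Rightarrow> ('p, 'l) nfa" where
  "nfa_map h B = \<lparr>nfa_states = h ` nfa_states B, nfa_initial = h (nfa_initial B),
     nfa_final = h ` nfa_final B, nfa_trans = (\<lambda>(q, x, q'). (h q, x, h q')) ` nfa_trans B\<rparr>"

lemma is_nfa_map: "is_nfa \<Lambda> B \<Longrightarrow> is_nfa \<Lambda> (nfa_map h B)"
  unfolding is_nfa_def nfa_map_def by auto

lemma nfa_run_mapI: "nfa_run B q u q' \<Longrightarrow> nfa_run (nfa_map h B) (h q) u (h q')"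
proof (induction rule: nfa_run.induct)
  case (nfa_run_Cons q x q' u q'')
  from nfa_run_Cons(1) have "(h q, x, h q') \<in> nfa_trans (nfa_map h B)"
    unfolding nfa_map_def by force
  then show ?case using nfa_run_Cons(3) by (rule nfa_run.nfa_run_Cons)
qed (rule nfa_run.nfa_run_Nil)

text \<open>A transition of the image comes from some transition of \<open>B\<close>; injectivity on
  the states makes its source the state already reached.\<close>

lemma nfa_run_mapD:
  assumes "nfa_run (nfa_map h B) p u p'" "is_nfa \<Lambda> B" "inj_on h (nfa_states B)"
    "p = h q" "q \<in> nfa_states B"
  shows "\<exists>q' \<in> nfa_states B. p' = h q' \<and> nfa_run B q u q'"
  using assms
proof (induction arbitrary: q rule: nfa_run.induct)
  case (nfa_run_Cons p x p1 u p')
  then obtain q0 q1 where t: "(q0, x, q1) \<in> nfa_trans B" "p = h q0" "p1 = h q1"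
    unfolding nfa_map_def by auto
  then have q: "q0 \<in> nfa_states B" "q1 \<in> nfa_states B"
    using nfa_run_Cons.prems(1) unfolding is_nfa_def by auto
  then have "q0 = q" using nfa_run_Cons.prems t(2) by (metis inj_onD)
  moreover obtain q' where "q' \<in> nfa_states B" "p' = h q'" "nfa_run B q1 u q'"
    using nfa_run_Cons.IH[OF nfa_run_Cons.prems(1,2) t(3) q(2)] by blast
  ultimately show ?case using t(1) by (blast intro: nfa_run.nfa_run_Cons)
qed (blast intro: nfa_run.nfa_run_Nil)

lemma nfa_language_map:
  assumes "is_nfa \<Lambda> B" "inj_on h (nfa_states B)"
  shows "nfa_language (nfa_map h B) = nfa_language B"
proof (intro equalityI subsetI)
  fix u assume "u \<in> nfa_language (nfa_map h B)"
  then obtain f where f: "f \<in> nfa_final B" "nfa_run (nfa_map h B) (h (nfa_initial B)) u (h f)"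
    unfolding nfa_language_def nfa_map_def by auto
  have B: "nfa_initial B \<in> nfa_states B" "nfa_final B \<subseteq> nfa_states B"
    using assms(1) unfolding is_nfa_def by auto
  obtain q' where "q' \<in> nfa_states B" "h f = h q'" "nfa_run B (nfa_initial B) u q'"
    using nfa_run_mapD[OF f(2) assms refl B(1)] by blast
  moreover from this have "q' = f" using assms(2) f(1) B(2) by (metis inj_onD subsetD)
  ultimately show "u \<in> nfa_language B" using f(1) unfolding nfa_language_def by blast
next
  fix u assume "u \<in> nfa_language B"
  then obtain f where "f \<in> nfa_final B" "nfa_run B (nfa_initial B) u f"
    unfolding nfa_language_def by blast
  then have "h f \<in> nfa_final (nfa_map h B)"
    "nfa_run (nfa_map h B) (nfa_initial (nfa_map h B)) u (h f)"
    using nfa_run_mapI[of B] by (auto simp: nfa_map_def)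
  then show "u \<in> nfa_language (nfa_map h B)" unfolding nfa_language_def by blast
qed

section \<open>Closure properties of computable functions\<close>

abbreviation pfst :: "nat \<Rightarrow> nat" where "pfst z \<equiv> fst (prod_decode z)"
abbreviation psnd :: "nat \<Rightarrow> nat" where "psnd z \<equiv> snd (prod_decode z)"

lemma recursive_comp1:
  assumes "recursive 1 (\<lambda>xs. F (xs ! 0))" "recursive n f"
  shows "recursive n (\<lambda>xs. F (f xs))"
  using rec_comp[of "[f]" "\<lambda>xs. F (xs ! 0)" n] assms by simp

lemma recursive_Suc: "recursive n f \<Longrightarrow> recursive n (\<lambda>xs. Suc (f xs))"
  by (rule recursive_comp1[OF rec_Suc])

text \<open>Primitive recursion with one parameter: the step function receives the counter, the
  accumulator and the parameter, in this order.\<close>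

lemma recursive_primrec1:
  assumes "recursive 1 f" "recursive 3 g" "recursive n b" "recursive n h"
  shows "recursive n (\<lambda>xs. rec_nat (f [h xs]) (\<lambda>y z. g [y, z, h xs]) (b xs))"
proof -
  have "recursive (length [b, h]) (\<lambda>xs. rec_nat (f (tl xs)) (\<lambda>y z. g (y # z # tl xs)) (hd xs))"
    using rec_primrec[of 1 f g] assms by (simp add: numeral_eq_Suc)
  from rec_comp[OF this, of n] assms show ?thesis by simp
qed

lemma recursive_add:
  assumes "recursive n f" "recursive n g"
  shows "recursive n (\<lambda>xs. f xs + g xs)"
proof -
  have *: "rec_nat b (\<lambda>y. Suc) a = a + b" for a b by (induction a) auto
  have "recursive 1 (\<lambda>xs. xs ! 0)" "recursive 3 (\<lambda>xs. Suc (xs ! 1))"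
    by (auto intro!: rec_proj recursive_Suc)
  from recursive_primrec1[OF this assms] show ?thesis by (simp add: *)
qed

lemma recursive_triangle:
  assumes "recursive n f"
  shows "recursive n (\<lambda>xs. triangle (f xs))"
proof -
  have *: "rec_nat 0 (\<lambda>y z. z + Suc y) a = triangle a" for a by (induction a) auto
  have "recursive 1 (\<lambda>xs. 0)" "recursive 3 (\<lambda>xs. xs ! 1 + Suc (xs ! 0))"
    by (auto intro!: rec_proj rec_zero recursive_Suc recursive_add)
  from recursive_primrec1[OF this assms assms] show ?thesis by (simp add: * del: add_Suc_right)
qed

lemma recursive_diff:
  assumes "recursive n f" "recursive n g"
  shows "recursive n (\<lambda>xs. f xs - g xs)"
proof -
  have pred: "rec_nat 0 (\<lambda>y z. y) a = a - 1" for a by (cases a) auto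
  have "recursive 1 (\<lambda>xs. 0)" "recursive 3 (\<lambda>xs. xs ! 0)"
    by (auto intro!: rec_proj rec_zero)
  from recursive_primrec1[OF this, of 3 "\<lambda>xs. xs ! 1" "\<lambda>xs. xs ! 1"]
  have 1: "recursive 3 (\<lambda>xs. xs ! 1 - 1)" by (simp add: pred rec_proj)
  have *: "rec_nat b (\<lambda>y z. z - 1) a = b - a" for a b by (induction a) auto
  have "recursive 1 (\<lambda>xs. xs ! 0)" by (auto intro!: rec_proj)
  \<comment> \<open>The recursion runs on the subtrahend, iterating the predecessor; hence the
    swapped arguments.\<close>
  from recursive_primrec1[OF this 1 assms(2,1)] show ?thesis using * by simp
qed

lemma recursive_prod_encode:
  assumes "recursive n f" "recursive n g"
  shows "recursive n (\<lambda>xs. prod_encode (f xs, g xs))"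
  unfolding prod_encode_def by (auto intro!: recursive_add recursive_triangle assms)

lemma computable_lift1:
  assumes "\<And>f. recursive 1 f \<Longrightarrow> recursive 1 (\<lambda>xs. F (f xs))" and "computable f"
  shows "computable (\<lambda>x. F (f x))"
proof -
  obtain f' where "recursive 1 f'" "\<And>x. f x = f' [x]"
    using assms(2) unfolding computable_def by auto
  then show ?thesis
    unfolding computable_def by (intro exI[of _ "\<lambda>xs. F (f' xs)"]) (simp add: assms(1)[simplified])
qed

lemma computable_lift2:
  assumes "\<And>f g. recursive 1 f \<Longrightarrow> recursive 1 g \<Longrightarrow> recursive 1 (\<lambda>xs. F (f xs) (g xs))"
    and "computable f" "computable g"
  shows "computable (\<lambda>x. F (f x) (g x))"
proof -
  obtain f' g' where "recursive 1 f'" "\<And>x. f x = f' [x]" "recursive 1 g'" "\<And>x. g x = g' [x]"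
    using assms(2,3) unfolding computable_def by auto
  then show ?thesis
    unfolding computable_def
    by (intro exI[of _ "\<lambda>xs. F (f' xs) (g' xs)"]) (simp add: assms(1)[simplified])
qed

lemma computable_Suc: "computable f \<Longrightarrow> computable (\<lambda>x. Suc (f x))"
  by (rule computable_lift1, rule recursive_Suc)

lemma computable_triangle: "computable f \<Longrightarrow> computable (\<lambda>x. triangle (f x))"
  by (rule computable_lift1, rule recursive_triangle)

lemma computable_add: "computable f \<Longrightarrow> computable g \<Longrightarrow> computable (\<lambda>x. f x + g x)"
  by (rule computable_lift2, rule recursive_add)

lemma computable_diff: "computable f \<Longrightarrow> computable g \<Longrightarrow> computable (\<lambda>x. f x - g x)"
  by (rule computable_lift2, rule recursive_diff)

lemma computable_prod_encode:
  "computable f \<Longrightarrow> computable g \<Longrightarrow> computable (\<lambda>x. prod_encode (f x, g x))"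
  by (rule computable_lift2, rule recursive_prod_encode)

lemma computable_id: "computable (\<lambda>x. x)"
  unfolding computable_def by (rule exI[of _ "\<lambda>xs. xs ! 0"]) (auto intro: rec_proj)

lemma computable_const: "computable (\<lambda>x. c)"
proof (induction c)
  case 0
  show ?case unfolding computable_def by (rule exI[of _ "\<lambda>xs. 0"]) (auto intro: rec_zero)
qed (rule computable_Suc)

lemma computable_comp:
  assumes "computable f" "computable g"
  shows "computable (\<lambda>x. f (g x))"
proof -
  obtain f' where f': "recursive 1 f'" "\<And>x. f x = f' [x]"
    using assms(1) unfolding computable_def by auto
  have "recursive 1 (\<lambda>xs. f (h xs))" if "recursive 1 h" for h
    using rec_comp[of "[h]" f' 1] f' that by simp
  then show ?thesis using assms(2) by (rule computable_lift1)
qed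

text \<open>The inverse of pairing is where minimization enters. The test
  \<open>z < triangle (Suc y)\<close> becomes the vanishing of a truncated difference, and
  \<open>y = z\<close> always passes it.\<close>

lemma computable_Least_triangle: "computable (\<lambda>z. LEAST y. z < triangle (Suc y))"
proof -
  have "recursive 2 (\<lambda>xs. Suc (xs ! 1) - triangle (Suc (xs ! 0)))"
    by (intro recursive_diff recursive_Suc recursive_triangle rec_proj) simp_all
  moreover have "\<exists>y. Suc z - triangle (Suc y) = 0" for z
    by (rule exI[of _ z]) simp
  ultimately have "recursive 1 (\<lambda>xs. LEAST y. Suc (xs ! 0) - triangle (Suc y) = 0)"
    using rec_mu[of 1 "\<lambda>xs. Suc (xs ! 1) - triangle (Suc (xs ! 0))"]
    by (simp add: numeral_2_eq_2)
  then show ?thesis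
    unfolding computable_def
    by (intro exI conjI, assumption) (simp add: less_Suc_eq_le)
qed

lemma triangle_mono: "m \<le> n \<Longrightarrow> triangle m \<le> triangle n"
  by (induction n) (auto simp: le_Suc_eq)

text \<open>The code of \<open>(a, b)\<close> is \<open>triangle (a + b) + a\<close>, which lies
  before the start of the next diagonal; the search thus finds the diagonal
  \<open>a + b\<close>.\<close>

lemma Least_triangle_prod_encode: "(LEAST y. prod_encode (a, b) < triangle (Suc y)) = a + b"
proof (rule Least_equality)
  fix y assume *: "prod_encode (a, b) < triangle (Suc y)"
  show "a + b \<le> y"
  proof (rule ccontr)
    assume "\<not> a + b \<le> y"
    then have "triangle (Suc y) \<le> triangle (a + b)" by (intro triangle_mono) simp
    with * show False by (simp add: prod_encode_def)
  qed
qed (simp add: prod_encode_def)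

lemma pfst_eq: "pfst z = z - triangle (LEAST y. z < triangle (Suc y))"
  and psnd_eq: "psnd z = (LEAST y. z < triangle (Suc y)) - pfst z"
proof -
  obtain a b where "prod_decode z = (a, b)" by fastforce
  then have z: "z = prod_encode (a, b)" by (metis prod_decode_inverse)
  show "pfst z = z - triangle (LEAST y. z < triangle (Suc y))"
    "psnd z = (LEAST y. z < triangle (Suc y)) - pfst z"
    unfolding z Least_triangle_prod_encode prod_encode_inverse by (simp_all add: prod_encode_def)
qed

lemma computable_pfst: "computable f \<Longrightarrow> computable (\<lambda>x. pfst (f x))"
  unfolding pfst_eq
  by (intro computable_diff computable_triangle computable_comp[OF computable_Least_triangle])

lemma computable_psnd: "computable f \<Longrightarrow> computable (\<lambda>x. psnd (f x))"
  unfolding psnd_eq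
  by (intro computable_diff computable_pfst computable_comp[OF computable_Least_triangle])

text \<open>The three arguments of the step are packed into one number, so that closure properties
  of unary functions suffice from here on.\<close>

lemma computable_rec_nat:
  assumes "computable f" "computable (\<lambda>v. g (pfst v) (pfst (psnd v)) (psnd (psnd v)))" "computable b"
  shows "computable (\<lambda>x. rec_nat (f x) (\<lambda>y z. g y z x) (b x))"
proof -
  obtain f' where f': "recursive 1 f'" "\<And>x. f x = f' [x]"
    using assms(1) unfolding computable_def by auto
  obtain g' where g': "recursive 1 g'"
      "\<And>v. g (pfst v) (pfst (psnd v)) (psnd (psnd v)) = g' [v]"
    using assms(2) unfolding computable_def by auto
  obtain b' where b': "recursive 1 b'" "\<And>x. b x = b' [x]"
    using assms(3) unfolding computable_def by auto
  let ?p = "\<lambda>xs :: nat list. prod_encode (xs ! 0, prod_encode (xs ! 1, xs ! 2))"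
  have "recursive 3 ?p"
    by (auto intro!: recursive_prod_encode rec_proj)
  then have "recursive 3 (\<lambda>xs. g' [?p xs])"
    using rec_comp[of "[?p]" g' 3] g'(1) by simp
  from recursive_primrec1[OF f'(1) this b'(1) rec_proj, of 0]
  show ?thesis
    unfolding computable_def
    by (rule_tac exI, rule_tac conjI, simp) (simp flip: f'(2) g'(2) b'(2))
qed

lemma computable_mult:
  assumes "computable f" "computable g"
  shows "computable (\<lambda>x. f x * g x)"
proof -
  have *: "rec_nat 0 (\<lambda>y z. z + m) n = n * m" for m n :: nat by (induction n) auto
  have "computable (\<lambda>x. rec_nat 0 (\<lambda>y z. z + g x) (f x))"
    by (intro computable_rec_nat computable_const computable_add computable_pfst computable_psnd
        computable_id computable_comp[OF assms(2)] assms(1))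
  then show ?thesis by (simp add: *)
qed

lemma computable_power2:
  assumes "computable f"
  shows "computable (\<lambda>x. 2 ^ f x)"
proof -
  have *: "rec_nat 1 (\<lambda>y z. z + z) n = (2 :: nat) ^ n" for n by (induction n) auto
  have "computable (\<lambda>x. rec_nat 1 (\<lambda>y z. z + z) (f x))"
    by (intro computable_rec_nat computable_const computable_add computable_pfst computable_psnd
        computable_id assms(1))
  then show ?thesis by (simp only: *)
qed

lemma computable_sum:
  assumes "computable (\<lambda>v. g (pfst v) (psnd v))" "computable b"
  shows "computable (\<lambda>x. \<Sum>y<b x. g y x)"
proof -
  have *: "rec_nat 0 (\<lambda>y z. z + h y) n = sum h {..<n}" for h and n :: nat
    by (induction n) auto
  have "computable (\<lambda>v. g (pfst v) (psnd (psnd v)))"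
    using computable_comp[OF assms(1), of "\<lambda>v. prod_encode (pfst v, psnd (psnd v))"]
    by (simp add: computable_prod_encode computable_pfst computable_psnd computable_id)
  then have "computable (\<lambda>x. rec_nat 0 (\<lambda>y z. z + g y x) (b x))"
    by (intro computable_rec_nat computable_const computable_add computable_pfst computable_psnd
        computable_id assms(2))
  then show ?thesis by (simp add: *)
qed

section \<open>Decidable predicates and bounded quantifiers\<close>

definition decidable :: "(nat \<Rightarrow> bool) \<Rightarrow> bool" where
  "decidable P \<longleftrightarrow> computable (\<lambda>x. of_bool (P x))"

lemma computable_if:
  assumes "decidable P" "computable f" "computable g"
  shows "computable (\<lambda>x. if P x then f x else g x)"
proof -
  have "computable (\<lambda>x. of_bool (P x) * f x + (1 - of_bool (P x)) * g x)"
    using assms unfolding decidable_def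
    by (intro computable_add computable_mult computable_diff computable_const)
  then show ?thesis by (rule back_subst[of computable]) auto
qed

lemma decidable_not:
  assumes "decidable P"
  shows "decidable (\<lambda>x. \<not> P x)"
proof -
  have "1 - of_bool b = (of_bool (\<not> b) :: nat)" for b by simp
  then show ?thesis
    using assms computable_diff[OF computable_const[of 1], of "\<lambda>x. of_bool (P x)"]
    unfolding decidable_def by (simp only:)
qed

lemma decidable_conj: "decidable P \<Longrightarrow> decidable Q \<Longrightarrow> decidable (\<lambda>x. P x \<and> Q x)"
  unfolding decidable_def of_bool_conj by (rule computable_mult)

lemma decidable_disj:
  assumes "decidable P" "decidable Q"
  shows "decidable (\<lambda>x. P x \<or> Q x)"
proof -
  have "decidable (\<lambda>x. \<not> (\<not> P x \<and> \<not> Q x))" by (intro decidable_not decidable_conj assms)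
  then show ?thesis by simp
qed

lemma decidable_imp:
  assumes "decidable P" "decidable Q"
  shows "decidable (\<lambda>x. P x \<longrightarrow> Q x)"
  unfolding imp_conv_disj by (intro decidable_not decidable_disj assms)

lemma decidable_le:
  assumes "computable f" "computable g"
  shows "decidable (\<lambda>x. f x \<le> g x)"
proof -
  have "computable (\<lambda>x. 1 - (f x - g x))"
    using assms by (intro computable_diff computable_const)
  moreover have "1 - (m - n) = of_bool (m \<le> n)" for m n :: nat by auto
  ultimately show ?thesis unfolding decidable_def by simp
qed

lemma decidable_less: "computable f \<Longrightarrow> computable g \<Longrightarrow> decidable (\<lambda>x. f x < g x)"
  unfolding Suc_le_eq[symmetric] by (intro decidable_le computable_Suc)

lemma decidable_eq: "computable f \<Longrightarrow> computable g \<Longrightarrow> decidable (\<lambda>x. f x = g x)"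
  unfolding eq_iff[of "_ :: nat"] by (intro decidable_le decidable_conj)

text \<open>Counts the witnesses by a bounded sum and tests whether there are any.\<close>

lemma decidable_bex:
  assumes "decidable (\<lambda>v. P (pfst v) (psnd v))" "computable b"
  shows "decidable (\<lambda>x. \<exists>y<b x. P y x)"
proof -
  have "decidable (\<lambda>x. 0 < (\<Sum>y<b x. of_bool (P y x) :: nat))"
    using assms unfolding decidable_def[of "\<lambda>v. P (pfst v) (psnd v)"]
    by (intro decidable_less computable_const computable_sum)
  then show ?thesis by (rule back_subst[of decidable]) (auto simp: zero_less_iff_neq_zero simp del: neq0_conv)
qed

lemma decidable_ball:
  assumes "decidable (\<lambda>v. P (pfst v) (psnd v))" "computable b"
  shows "decidable (\<lambda>x. \<forall>y<b x. P y x)"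
proof -
  have "decidable (\<lambda>x. \<not> (\<exists>y<b x. \<not> P y x))" by (intro decidable_not decidable_bex assms)
  then show ?thesis by simp
qed

text \<open>Expresses that bit \<open>i\<close> of \<open>c\<close> is set by splitting
  \<open>c\<close> at this bit, which replaces division by bounded quantifiers over sums, products
  and powers of two.\<close>

lemma in_set_decode_iff:
  "i \<in> set_decode c \<longleftrightarrow> (\<exists>q<Suc c. \<exists>r<2 ^ i. c = Suc (q + q) * 2 ^ i + r)"
proof
  assume "i \<in> set_decode c"
  then obtain q where q: "c div 2 ^ i = Suc (q + q)"
    unfolding set_decode_def by (auto elim!: oddE simp: mult_2)
  have "q \<le> c" using q div_le_dividend[of c "2 ^ i"] by simp
  moreover have "c = Suc (q + q) * 2 ^ i + c mod 2 ^ i" using div_mult_mod_eq[of c "2 ^ i"] q by simp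
  ultimately show "\<exists>q<Suc c. \<exists>r<2 ^ i. c = Suc (q + q) * 2 ^ i + r"
    by (metis le_imp_less_Suc mod_less_divisor zero_less_numeral zero_less_power)
next
  assume "\<exists>q<Suc c. \<exists>r<2 ^ i. c = Suc (q + q) * 2 ^ i + r"
  then obtain q r where "r < 2 ^ i" "c = Suc (q + q) * 2 ^ i + r" by blast
  then have "c div 2 ^ i = Suc (q + q)" by (intro div_nat_eqI) auto
  then show "i \<in> set_decode c" by (simp add: set_decode_def)
qed

lemmas computable_basic_intros =
  computable_id computable_const computable_Suc computable_add computable_diff computable_mult
  computable_power2 computable_prod_encode computable_pfst computable_psnd
  decidable_not decidable_conj decidable_disj decidable_imp decidable_eq decidable_bex decidable_ball

lemma decidable_in_set_decode:
  assumes "computable f" "computable g"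
  shows "decidable (\<lambda>x. f x \<in> set_decode (g x))"
  unfolding in_set_decode_iff
  by (intro computable_basic_intros computable_comp[OF assms(1)] computable_comp[OF assms(2)])

text \<open>A finite set is output as the sum of the powers of two of its elements; a common bound
  on these makes the sum bounded.\<close>

lemma computable_set_encode:
  assumes "decidable (\<lambda>v. P (pfst v) (psnd v))" "computable b"
  shows "computable (\<lambda>x. set_encode {y. y < b x \<and> P y x})"
proof -
  have "set_encode {y. y < n \<and> Q y} = (\<Sum>y<n. if Q y then 2 ^ y else 0)" for n Q
    unfolding set_encode_def by (auto simp: sum.If_cases intro!: sum.cong)
  moreover have "computable (\<lambda>x. \<Sum>y<b x. if P y x then 2 ^ y else 0)"
    by (intro computable_basic_intros computable_sum computable_if assms)
  ultimately show ?thesis by simp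
qed

lemmas computable_intros = computable_basic_intros decidable_in_set_decode computable_set_encode

section \<open>Coding the automaton by numbers\<close>

definition rel_encode :: "(nat \<times> nat) set \<Rightarrow> nat" where
  "rel_encode R = set_encode (prod_encode ` R)"

definition rel_decode :: "nat \<Rightarrow> (nat \<times> nat) set" where
  "rel_decode c = {(m, r). prod_encode (m, r) \<in> set_decode c}"

lemma rel_decode_iff: "(m, r) \<in> rel_decode c \<longleftrightarrow> prod_encode (m, r) \<in> set_decode c"
  by (simp add: rel_decode_def)

lemma rel_decode_encode [simp]: "finite R \<Longrightarrow> rel_decode (rel_encode R) = R"
  unfolding rel_decode_def rel_encode_def by auto

text \<open>Every number codes exactly one finite relation, so equality of relations can be tested
  as equality of numbers.\<close>

lemma rel_encode_decode [simp]: "rel_encode (rel_decode c) = c"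
proof -
  have "j \<in> prod_encode ` rel_decode c" if "j \<in> set_decode c" for j
    using that by (intro image_eqI[of _ _ "prod_decode j"]) (auto simp: rel_decode_def split: prod.split)
  then have "prod_encode ` rel_decode c = set_decode c" by (auto simp: rel_decode_def)
  then show ?thesis by (simp add: rel_encode_def)
qed

lemma inj_rel_decode: "rel_decode c = rel_decode c' \<longleftrightarrow> c = c'"
  by (metis rel_encode_decode)

lemma rel_encode_empty [simp]: "rel_encode {} = 0"
  by (simp add: rel_encode_def)

lemma rel_decode_insert:
  assumes "(m, r) \<notin> rel_decode c"
  shows "rel_decode c' = insert (m, r) (rel_decode c) \<longleftrightarrow> c' = 2 ^ prod_encode (m, r) + c"
proof -
  have "rel_decode (2 ^ prod_encode (m, r) + c) = insert (m, r) (rel_decode c)"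
    using assms unfolding rel_decode_def by (auto simp: set_decode_plus_power_2)
  then show ?thesis by (metis inj_rel_decode)
qed

text \<open>Clearing a set bit subtracts its power of two; written as an addition to
  \<open>c'\<close>, the condition avoids truncated subtraction.\<close>

lemma rel_decode_remove:
  assumes "(m, r) \<in> rel_decode c"
  shows "rel_decode c' = rel_decode c - {(m, r)} \<longleftrightarrow> c = 2 ^ prod_encode (m, r) + c'"
proof -
  let ?p = "prod_encode (m, r)"
  define d where "d = set_encode (set_decode c - {?p})"
  have "set_encode (insert ?p (set_decode c - {?p})) = 2 ^ ?p + d"
    unfolding d_def by (rule set_encode_insert) auto
  moreover have "insert ?p (set_decode c - {?p}) = set_decode c"
    using assms by (auto simp: rel_decode_iff)
  ultimately have c: "c = 2 ^ ?p + d" by simp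
  have "rel_decode d = rel_decode c - {(m, r)}"
    unfolding rel_decode_def d_def by auto
  then show ?thesis using c by (metis add_left_imp_eq inj_rel_decode)
qed

text \<open>From \<open>j < 2 ^ j \<le> c\<close>. It is the source of the bounds for quantifiers
  over elements of coded sets.\<close>

lemma in_set_decode_less: "j \<in> set_decode c \<Longrightarrow> j < c"
proof -
  assume "j \<in> set_decode c"
  then have "0 < c div 2 ^ j" by (auto simp: set_decode_def intro: odd_pos)
  then have "2 ^ j \<le> c" by (simp add: div_greater_zero_iff)
  then show ?thesis using less_exp[of j] by linarith
qed

lemma prod_encode_mono: "a \<le> a' \<Longrightarrow> b \<le> b' \<Longrightarrow> prod_encode (a, b) \<le> prod_encode (a', b')"
  unfolding prod_encode_def by (auto intro!: add_mono triangle_mono)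

lemma prod_encode_strict_mono: "a < a' \<Longrightarrow> b \<le> b' \<Longrightarrow> prod_encode (a, b) < prod_encode (a', b')"
  unfolding prod_encode_def by (auto intro!: add_le_less_mono triangle_mono)

lemma set_encode_less_power: "X \<subseteq> {..<n} \<Longrightarrow> set_encode X < 2 ^ n"
proof -
  assume "X \<subseteq> {..<n}"
  then have "set_encode X \<le> (\<Sum>i<n. 2 ^ i)" unfolding set_encode_def by (intro sum_mono2) auto
  also have "\<dots> < 2 ^ n" by (induction n) auto
  finally show ?thesis .
qed

lemma action_code_simps: "action_code (Fresh r) = r + r" "action_code (Reuse r) = Suc (r + r)"
  by (simp_all add: sum_encode_def)

lemma inj_action_code: "action_code \<alpha> = action_code \<beta> \<longleftrightarrow> \<alpha> = \<beta>"
  by (cases \<alpha>; cases \<beta>) (simp_all add: sum_encode_eq)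

text \<open>In the following predicates, \<open>K\<close> is the code of the register set \<open>{1..k}\<close>.\<close>

definition rel_code :: "nat \<Rightarrow> nat \<Rightarrow> bool" where
  "rel_code K c \<longleftrightarrow> (\<forall>j<c. j \<in> set_decode c \<longrightarrow> pfst j \<in> set_decode K \<and> psnd j \<in> set_decode K)"

text \<open>Even codes are fresh actions and odd ones reuses. Names start at 1, hence the exception
  \<open>j = 0\<close> in the minimality test.\<close>

definition step_code :: "nat \<Rightarrow> nat \<Rightarrow> nat \<Rightarrow> nat \<Rightarrow> nat \<Rightarrow> bool" where
  "step_code K c \<alpha> \<pi> c' \<longleftrightarrow>
     (\<exists>r<Suc \<alpha>. \<exists>m<Suc \<pi>.
        \<alpha> = r + r \<and> \<pi> = m + m \<and> m \<in> set_decode K \<and>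
        \<not> (\<exists>i<c. prod_encode (m, i) \<in> set_decode c) \<and>
        (\<forall>j<m. j = 0 \<or> (\<exists>i<c. prod_encode (j, i) \<in> set_decode c)) \<and>
        \<not> (\<exists>j<c. prod_encode (j, r) \<in> set_decode c) \<and>
        (c' = c \<or> c' = 2 ^ prod_encode (m, r) + c) \<or>
        \<alpha> = Suc (r + r) \<and> \<pi> = Suc (m + m) \<and> prod_encode (m, r) \<in> set_decode c \<and>
        (c' = c \<or> c = 2 ^ prod_encode (m, r) + c'))"

text \<open>\<open>t\<close> codes \<open>((s, R), (a, \<pi>), (s', R'))\<close>. The hidden action
  \<open>\<alpha>\<close> is a component of a member of the set coded by \<open>T\<close>, so its
  code is below \<open>T\<close>.\<close>

definition trans_pred :: "nat \<Rightarrow> nat \<Rightarrow> nat \<Rightarrow> bool" where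
  "trans_pred K T t \<longleftrightarrow>
     rel_code K (psnd (pfst t)) \<and> rel_code K (psnd (psnd (psnd t))) \<and>
     (\<exists>\<alpha><T. prod_encode (pfst (pfst t), prod_encode (prod_encode (pfst (pfst (psnd t)), \<alpha>),
           pfst (psnd (psnd t)))) \<in> set_decode T \<and>
        step_code K (psnd (pfst t)) \<alpha> (psnd (pfst (psnd t))) (psnd (psnd (psnd t))))"

text \<open>A state number is below \<open>S\<close>, a register below \<open>K\<close>; a pair of
  registers is thus below \<open>prod_encode (K, K)\<close>, and a set of such pairs has a code
  below the power of two.\<close>

definition states_bound :: "nat \<Rightarrow> nat \<Rightarrow> nat" where
  "states_bound S K = prod_encode (S, 2 ^ prod_encode (K, K))"

text \<open>\<open>T\<close> exceeds the code of any symbol in a transition;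
  \<open>Suc (K + K)\<close> bounds the code of an action whose name is below
  \<open>K\<close>.\<close>

definition trans_bound :: "nat \<Rightarrow> nat \<Rightarrow> nat \<Rightarrow> nat" where
  "trans_bound S K T = prod_encode (states_bound S K,
     prod_encode (prod_encode (T, Suc (K + K)), states_bound S K))"

definition snf_nfa_code :: "nat \<Rightarrow> nat \<Rightarrow> nat \<Rightarrow> nat \<Rightarrow> nat \<Rightarrow> nat" where
  "snf_nfa_code S K i F T = list_encode
     [set_encode {q. q < states_bound S K \<and> pfst q \<in> set_decode S \<and> rel_code K (psnd q)},
      prod_encode (i, 0),
      set_encode {q. q < states_bound S K \<and> pfst q \<in> set_decode F \<and> psnd q = 0},
      set_encode {t. t < trans_bound S K T \<and> trans_pred K T t}]"

text \<open>\<open>list_encode\<close> is the successor of a pair code on non-empty lists, hence the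
  subtraction of 1.\<close>

definition code_hd :: "nat \<Rightarrow> nat" where "code_hd x = pfst (x - 1)"
definition code_tl :: "nat \<Rightarrow> nat" where "code_tl x = psnd (x - 1)"

lemma code_hd_tl [simp]:
  "code_hd (list_encode (x # xs)) = x" "code_tl (list_encode (x # xs)) = list_encode xs"
  by (simp_all add: code_hd_def code_tl_def)

definition snf_compile :: "nat \<Rightarrow> nat" where
  "snf_compile x = snf_nfa_code (code_hd x) (code_hd (code_tl x)) (code_hd (code_tl (code_tl x)))
     (code_hd (code_tl (code_tl (code_tl x)))) (code_hd (code_tl (code_tl (code_tl (code_tl x)))))"

section \<open>Computability of the translation on codes\<close>

lemma decidable_rel_code:
  assumes "computable K" "computable c"
  shows "decidable (\<lambda>x. rel_code (K x) (c x))"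
  unfolding rel_code_def by (intro computable_intros assms[THEN computable_comp])

lemma decidable_step_code:
  assumes "computable K" "computable c" "computable \<alpha>" "computable \<pi>" "computable c'"
  shows "decidable (\<lambda>x. step_code (K x) (c x) (\<alpha> x) (\<pi> x) (c' x))"
  unfolding step_code_def by (intro computable_intros assms[THEN computable_comp])

lemma decidable_trans_pred:
  assumes "computable K" "computable T" "computable t"
  shows "decidable (\<lambda>x. trans_pred (K x) (T x) (t x))"
  unfolding trans_pred_def
  by (intro computable_intros decidable_rel_code decidable_step_code assms[THEN computable_comp] assms)

lemma computable_snf_nfa_code:
  assumes "computable S" "computable K" "computable i" "computable F" "computable T"
  shows "computable (\<lambda>x. snf_nfa_code (S x) (K x) (i x) (F x) (T x))"
  unfolding snf_nfa_code_def states_bound_def trans_bound_def list_encode.simps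
  by (intro computable_intros decidable_rel_code decidable_trans_pred assms[THEN computable_comp] assms)

lemma computable_snf_compile: "computable snf_compile"
  unfolding snf_compile_def[abs_def] code_hd_def code_tl_def
  by (intro computable_snf_nfa_code computable_intros)

section \<open>Agreement of the predicates on codes with the automaton\<close>

lemma rel_code_iff: "rel_code (set_encode {1..k}) c \<longleftrightarrow> rel_decode c \<subseteq> {1..k} \<times> {1..k}"
proof
  assume c: "rel_code (set_encode {1..k}) c"
  show "rel_decode c \<subseteq> {1..k} \<times> {1..k}"
  proof (rule subrelI)
    fix m r assume "(m, r) \<in> rel_decode c"
    then have *: "prod_encode (m, r) \<in> set_decode c" by (simp add: rel_decode_iff)
    then show "(m, r) \<in> {1..k} \<times> {1..k}"
      using c[unfolded rel_code_def, rule_format, OF in_set_decode_less[OF *] *] by simp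
  qed
next
  assume c: "rel_decode c \<subseteq> {1..k} \<times> {1..k}"
  have "pfst j \<in> {1..k} \<and> psnd j \<in> {1..k}" if "j \<in> set_decode c" for j
  proof -
    have "(pfst j, psnd j) \<in> rel_decode c" using that unfolding rel_decode_iff by simp
    then show ?thesis using c by blast
  qed
  then show "rel_code (set_encode {1..k}) c" unfolding rel_code_def by simp
qed

lemma Domain_rel_decode: "m \<in> Domain (rel_decode c) \<longleftrightarrow> (\<exists>i<c. prod_encode (m, i) \<in> set_decode c)"
proof -
  have "i < c" if "prod_encode (m, i) \<in> set_decode c" for i
    using in_set_decode_less[OF that] le_prod_encode_2[of i m] by simp
  then show ?thesis by (auto simp: Domain_iff Range_iff rel_decode_iff)
qed

lemma Range_rel_decode: "r \<in> Range (rel_decode c) \<longleftrightarrow> (\<exists>j<c. prod_encode (j, r) \<in> set_decode c)"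
proof -
  have "j < c" if "prod_encode (j, r) \<in> set_decode c" for j
    using in_set_decode_less[OF that] le_prod_encode_1[of j r] by simp
  then show ?thesis by (auto simp: Domain_iff Range_iff rel_decode_iff)
qed

lemma step_code_iff:
  "step_code (set_encode {1..k}) c a p c' \<longleftrightarrow>
     (\<exists>\<alpha> \<pi>. a = action_code \<alpha> \<and> p = action_code \<pi> \<and> snf_step k (rel_decode c) \<alpha> \<pi> (rel_decode c'))"
proof -
  let ?fresh = "\<lambda>r m. a = r + r \<and> p = m + m \<and> m \<in> set_decode (set_encode {1..k}) \<and>
        \<not> (\<exists>i<c. prod_encode (m, i) \<in> set_decode c) \<and>
        (\<forall>j<m. j = 0 \<or> (\<exists>i<c. prod_encode (j, i) \<in> set_decode c)) \<and>
        \<not> (\<exists>j<c. prod_encode (j, r) \<in> set_decode c) \<and>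
        (c' = c \<or> c' = 2 ^ prod_encode (m, r) + c)"
  let ?reuse = "\<lambda>r m. a = Suc (r + r) \<and> p = Suc (m + m) \<and> prod_encode (m, r) \<in> set_decode c \<and>
        (c' = c \<or> c = 2 ^ prod_encode (m, r) + c')"
  have fresh: "?fresh r m \<longleftrightarrow> a = action_code (Fresh r) \<and> p = action_code (Fresh m) \<and>
      snf_step k (rel_decode c) (Fresh r) (Fresh m) (rel_decode c')" for r m
  proof -
    have "(\<forall>j<m. j = 0 \<or> (\<exists>i<c. prod_encode (j, i) \<in> set_decode c)) \<longleftrightarrow>
        {1..<m} \<subseteq> Domain (rel_decode c)"
      unfolding Domain_rel_decode[symmetric] by (auto simp: subset_iff Suc_le_eq)
    moreover have "c' = c \<or> c' = 2 ^ prod_encode (m, r) + c \<longleftrightarrow>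
        rel_decode c' = rel_decode c \<or> rel_decode c' = insert (m, r) (rel_decode c)"
      if "m \<notin> Domain (rel_decode c)"
      using rel_decode_insert[of m r c c'] inj_rel_decode that by blast
    ultimately show ?thesis
      unfolding action_code_simps snf_step.simps Domain_rel_decode[symmetric] Range_rel_decode[symmetric]
      by (auto simp del: One_nat_def)
  qed
  have reuse: "?reuse r m \<longleftrightarrow> a = action_code (Reuse r) \<and> p = action_code (Reuse m) \<and>
      snf_step k (rel_decode c) (Reuse r) (Reuse m) (rel_decode c')" for r m
    unfolding action_code_simps snf_step.simps rel_decode_iff[symmetric]
    using rel_decode_remove[of m r c c'] inj_rel_decode by blast
  have "step_code (set_encode {1..k}) c a p c' \<longleftrightarrow> (\<exists>r m. ?fresh r m \<or> ?reuse r m)"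
  proof
    assume "step_code (set_encode {1..k}) c a p c'"
    then show "\<exists>r m. ?fresh r m \<or> ?reuse r m" unfolding step_code_def by blast
  next
    assume "\<exists>r m. ?fresh r m \<or> ?reuse r m"
    then obtain r m where *: "?fresh r m \<or> ?reuse r m" by blast
    \<comment> \<open>An action code is at least its register, so the bounds in
      \<open>step_code\<close> exclude nothing.\<close>
    then have "r < Suc a" "m < Suc p" by auto
    with * show "step_code (set_encode {1..k}) c a p c'" unfolding step_code_def by blast
  qed
  also have "\<dots> \<longleftrightarrow> (\<exists>\<alpha> \<pi>. a = action_code \<alpha> \<and> p = action_code \<pi> \<and>
      snf_step k (rel_decode c) \<alpha> \<pi> (rel_decode c'))"
    unfolding fresh reuse
  proof (intro iffI; elim exE)
    fix \<alpha> \<pi> assume *: "a = action_code \<alpha> \<and> p = action_code \<pi> \<and> snf_step k (rel_decode c) \<alpha> \<pi> (rel_decode c')"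
    then show "\<exists>r m. a = action_code (Fresh r) \<and> p = action_code (Fresh m) \<and>
        snf_step k (rel_decode c) (Fresh r) (Fresh m) (rel_decode c') \<or>
      a = action_code (Reuse r) \<and> p = action_code (Reuse m) \<and>
        snf_step k (rel_decode c) (Reuse r) (Reuse m) (rel_decode c')"
      by (cases \<alpha>; cases \<pi>) (blast | simp)+
  qed blast
  finally show ?thesis .
qed

definition state_code :: "('s \<Rightarrow> nat) \<Rightarrow> 's \<times> (nat \<times> nat) set \<Rightarrow> nat" where
  "state_code es = (\<lambda>(s, R). prod_encode (es s, rel_encode R))"

context
  fixes \<Sigma> :: "'a set" and A :: "('s, 'a, nat) session_automaton" and k :: nat
  assumes A: "is_session_automaton \<Sigma> A" and k: "registers A = {1..k}"
begin

lemma is_nfa_snf_nfa: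
  assumes "finite \<Sigma>"
  shows "is_nfa (\<Sigma> \<times> Gamma k) (snf_nfa k A)"
proof -
  have "nfa_trans (snf_nfa k A) \<subseteq> nfa_states (snf_nfa k A) \<times> (\<Sigma> \<times> Gamma k) \<times> nfa_states (snf_nfa k A)"
  proof
    fix t assume "t \<in> nfa_trans (snf_nfa k A)"
    then obtain s R a \<pi> s' R' \<alpha> where t: "t = ((s, R), (a, \<pi>), (s', R'))"
      and tr: "(s, (a, \<alpha>), s') \<in> transitions A" and R: "R \<subseteq> {1..k} \<times> {1..k}" "R' \<subseteq> {1..k} \<times> {1..k}"
      and step: "snf_step k R \<alpha> \<pi> R'"
      unfolding snf_nfa_def by auto
    have "s \<in> states A" "s' \<in> states A" "a \<in> \<Sigma>" using tr A by (auto simp: is_session_automaton_def)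
    moreover have "\<pi> \<in> Gamma k"
      using step R by (cases \<alpha>; cases \<pi>) (auto simp: actions_def)
    ultimately show "t \<in> nfa_states (snf_nfa k A) \<times> (\<Sigma> \<times> Gamma k) \<times> nfa_states (snf_nfa k A)"
      using R by (simp add: t snf_nfa_def)
  qed
  moreover have "finite (\<Sigma> \<times> Gamma k)" using assms by (simp add: actions_def)
  moreover have "finite (nfa_states (snf_nfa k A))" "nfa_initial (snf_nfa k A) \<in> nfa_states (snf_nfa k A)"
    "nfa_final (snf_nfa k A) \<subseteq> nfa_states (snf_nfa k A)"
    using A by (auto simp: snf_nfa_def is_session_automaton_def)
  ultimately show ?thesis by (simp only: is_nfa_def simp_thms)
qed

lemma inj_state_code:
  assumes "inj_on es (states A)"
  shows "inj_on (state_code es) (nfa_states (snf_nfa k A))"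
proof (rule inj_onI, clarsimp simp: snf_nfa_def state_code_def)
  fix s R s' R'
  assume *: "s \<in> states A" "s' \<in> states A" "es s = es s'" "R \<subseteq> {Suc 0..k} \<times> {Suc 0..k}"
    "R' \<subseteq> {Suc 0..k} \<times> {Suc 0..k}" "rel_encode R = rel_encode R'"
  then have "finite R" "finite R'" by (auto intro: finite_subset)
  with * show "s = s' \<and> R = R'" using assms by (metis inj_onD rel_decode_encode)
qed

lemma card_snf_nfa_states: "card (nfa_states (snf_nfa k A)) = card (states A) * 2 ^ (k * k)"
  by (simp add: snf_nfa_def card_cartesian_product card_Pow)

lemma state_code_less:
  assumes "s \<in> states A" "R \<subseteq> {1..k} \<times> {1..k}"
  shows "state_code es (s, R) < states_bound (set_encode (es ` states A)) (set_encode {1..k})"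
proof -
  let ?K = "set_encode {1..k}"
  have "finite (states A)" using A by (simp add: is_session_automaton_def)
  then have "es s < set_encode (es ` states A)"
    using assms(1) by (intro in_set_decode_less) simp
  moreover have "rel_encode R < 2 ^ prod_encode (?K, ?K)"
    unfolding rel_encode_def
  proof (intro set_encode_less_power subsetI)
    fix j assume "j \<in> prod_encode ` R"
    then obtain m r where j: "j = prod_encode (m, r)" "m \<in> {1..k}" "r \<in> {1..k}" using assms(2) by auto
    then have "m < ?K" "r < ?K" by (auto intro!: in_set_decode_less)
    then show "j \<in> {..<prod_encode (?K, ?K)}" by (simp add: j prod_encode_strict_mono)
  qed
  ultimately show ?thesis
    unfolding state_code_def states_bound_def by (simp add: prod_encode_strict_mono)
qed

text \<open>The bound excludes no state by \<open>state_code_less\<close>; conversely a number that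
  passes the tests decodes to a state.\<close>

lemma code_nfa_states:
  "state_code es ` nfa_states (snf_nfa k A) =
     {q. q < states_bound (set_encode (es ` states A)) (set_encode {1..k}) \<and>
         pfst q \<in> set_decode (set_encode (es ` states A)) \<and> rel_code (set_encode {1..k}) (psnd q)}"
    (is "?L = ?R")
proof -
  have fin: "finite (states A)" using A by (simp add: is_session_automaton_def)
  show ?thesis
  proof (intro equalityI subsetI)
    fix q assume "q \<in> ?L"
    then obtain s R where q: "q = state_code es (s, R)" "s \<in> states A" "R \<subseteq> {1..k} \<times> {1..k}"
      by (auto simp: snf_nfa_def)
    moreover have "finite R" using q(3) by (rule finite_subset) simp
    ultimately show "q \<in> ?R"
      using state_code_less[OF q(2,3), of es] fin unfolding rel_code_iff
      by (simp add: q(1) state_code_def)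
  next
    fix q assume "q \<in> ?R"
    then obtain s where "s \<in> states A" "es s = pfst q" "rel_decode (psnd q) \<subseteq> {1..k} \<times> {1..k}"
      using fin unfolding rel_code_iff by auto
    then show "q \<in> ?L"
      by (intro image_eqI[of _ _ "(s, rel_decode (psnd q))"]) (auto simp: state_code_def snf_nfa_def)
  qed
qed

lemma code_nfa_final:
  "state_code es ` nfa_final (snf_nfa k A) =
     {q. q < states_bound (set_encode (es ` states A)) (set_encode {1..k}) \<and>
         pfst q \<in> set_decode (set_encode (es ` final A)) \<and> psnd q = 0}"
    (is "?L = ?R")
proof -
  have sub: "final A \<subseteq> states A" and fin: "finite (final A)"
    using A finite_subset by (auto simp: is_session_automaton_def)
  show ?thesis
  proof (intro equalityI subsetI)
    fix q assume "q \<in> ?L"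
    then obtain s where q: "q = state_code es (s, {})" "s \<in> final A" by (auto simp: snf_nfa_def)
    then show "q \<in> ?R"
      using state_code_less[of s "{}" es] sub fin by (auto simp: state_code_def)
  next
    fix q assume "q \<in> ?R"
    then obtain s where "s \<in> final A" "es s = pfst q" "psnd q = 0" using fin by auto
    moreover from this have "q = state_code es (s, {})"
      by (simp add: state_code_def) (metis prod.collapse prod_decode_inverse)
    ultimately show "q \<in> ?L" by (auto simp: snf_nfa_def)
  qed
qed

lemma code_nfa_trans:
  fixes es :: "'s \<Rightarrow> nat" and ea :: "'a \<Rightarrow> nat"
  defines "T \<equiv> trans_code es (letter_code ea) (transitions A)"
  shows "(\<lambda>(q, x, q'). prod_encode (state_code es q, prod_encode (letter_code ea x, state_code es q'))) `
       nfa_trans (snf_nfa k A) =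
     {t. t < trans_bound (set_encode (es ` states A)) (set_encode {1..k}) T \<and>
         trans_pred (set_encode {1..k}) T t}"
    (is "?code ` _ = ?R")
proof -
  let ?K = "set_encode {1..k}"
  have T: "set_decode T = (\<lambda>(q, x, q'). prod_encode (es q, prod_encode (letter_code ea x, es q'))) ` transitions A"
    unfolding T_def trans_code_def using A by (simp add: is_session_automaton_def)
  show ?thesis
  proof (intro equalityI subsetI)
    fix t assume "t \<in> ?code ` nfa_trans (snf_nfa k A)"
    then obtain s R a \<pi> s' R' \<alpha> where t: "t = ?code ((s, R), (a, \<pi>), (s', R'))"
      and tr: "(s, (a, \<alpha>), s') \<in> transitions A" and R: "R \<subseteq> {1..k} \<times> {1..k}" "R' \<subseteq> {1..k} \<times> {1..k}"
      and step: "snf_step k R \<alpha> \<pi> R'"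
      unfolding snf_nfa_def by auto
    have s: "s \<in> states A" "s' \<in> states A" using tr A by (auto simp: is_session_automaton_def)
    have finR: "finite R" "finite R'" using R by (auto intro: finite_subset)
    let ?t = "prod_encode (es s, prod_encode (prod_encode (ea a, action_code \<alpha>), es s'))"
    have mem: "?t \<in> set_decode T" unfolding T using tr by (force simp: letter_code_def)
    \<comment> \<open>A pair code is at least each of its components, so anything nested in a member
      of the set coded by \<open>T\<close> is below \<open>T\<close>.\<close>
    have "prod_encode (ea a, action_code \<alpha>) \<le> ?t"
      using le_prod_encode_1 le_prod_encode_2 le_trans by metis
    then have le: "ea a \<le> ?t" "action_code \<alpha> \<le> ?t"
      using le_prod_encode_1[of "ea a" "action_code \<alpha>"] le_prod_encode_2[of "action_code \<alpha>" "ea a"]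
      by auto
    have lt: "ea a < T" "action_code \<alpha> < T" using le in_set_decode_less[OF mem] by auto
    have "reg \<pi> \<in> {1..k}" using step R by (cases \<alpha>; cases \<pi>) auto
    then have "reg \<pi> < ?K" by (intro in_set_decode_less) simp
    then have \<pi>: "action_code \<pi> \<le> Suc (?K + ?K)" by (cases \<pi>) (simp_all add: sum_encode_def)
    have "t < trans_bound (set_encode (es ` states A)) ?K T"
      unfolding t trans_bound_def prod.case letter_code_def
      using state_code_less[OF s(1) R(1), of es] state_code_less[OF s(2) R(2), of es] lt(1) \<pi>
      by (intro prod_encode_strict_mono prod_encode_mono) auto
    moreover have "trans_pred ?K T t"
      unfolding trans_pred_def step_code_iff rel_code_iff t using mem lt(2) step R finR
      by (auto simp: state_code_def letter_code_def intro!: exI[of _ "action_code \<alpha>"])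
    ultimately show "t \<in> ?R" by simp
  next
    fix t assume "t \<in> ?R"
    then obtain \<alpha>' where R: "rel_decode (psnd (pfst t)) \<subseteq> {1..k} \<times> {1..k}"
        "rel_decode (psnd (psnd (psnd t))) \<subseteq> {1..k} \<times> {1..k}"
      and mem: "prod_encode (pfst (pfst t), prod_encode (prod_encode (pfst (pfst (psnd t)), \<alpha>'),
           pfst (psnd (psnd t)))) \<in> set_decode T"
      and step: "step_code ?K (psnd (pfst t)) \<alpha>' (psnd (pfst (psnd t))) (psnd (psnd (psnd t)))"
      unfolding trans_pred_def rel_code_iff by blast
    from mem obtain s a \<alpha> s' where tr: "(s, (a, \<alpha>), s') \<in> transitions A"
      and eq: "es s = pfst (pfst t)" "ea a = pfst (pfst (psnd t))" "\<alpha>' = action_code \<alpha>"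
        "es s' = pfst (psnd (psnd t))"
      unfolding T by (auto simp: letter_code_def)
    \<comment> \<open>Injectivity of \<open>action_code\<close> identifies the action found in
      \<open>step_code\<close> with that of the transition of \<open>A\<close>.\<close>
    from step obtain \<pi> where \<pi>: "psnd (pfst (psnd t)) = action_code \<pi>"
      and step': "snf_step k (rel_decode (psnd (pfst t))) \<alpha> \<pi> (rel_decode (psnd (psnd (psnd t))))"
      unfolding step_code_iff eq(3) inj_action_code by blast
    have "t = ?code ((s, rel_decode (psnd (pfst t))), (a, \<pi>), (s', rel_decode (psnd (psnd (psnd t)))))"
      by (simp add: state_code_def letter_code_def eq flip: \<pi>)
    moreover have "((s, rel_decode (psnd (pfst t))), (a, \<pi>), (s', rel_decode (psnd (psnd (psnd t)))))
        \<in> nfa_trans (snf_nfa k A)"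
      using tr step' R unfolding snf_nfa_def by auto
    ultimately show "t \<in> ?code ` nfa_trans (snf_nfa k A)" by (rule image_eqI)
  qed
qed

text \<open>The renamed automaton has the numbers \<open>state_code es (s, R)\<close> as states, and
  the preceding identities describe its components using only the entries of
  \<open>sa_code\<close>.\<close>

lemma snf_compile_sa_code:
  "snf_compile (sa_code es ea A) = nfa_code ea (nfa_map (state_code es) (snf_nfa k A))"
proof -
  have "trans_code id (letter_code ea) (nfa_trans (nfa_map (state_code es) (snf_nfa k A))) =
    set_encode ((\<lambda>(q, x, q'). prod_encode (state_code es q, prod_encode (letter_code ea x, state_code es q'))) `
       nfa_trans (snf_nfa k A))"
    unfolding trans_code_def nfa_map_def
    by (simp add: image_image case_prod_unfold)
  then show ?thesis
    unfolding nfa_code_def snf_compile_def sa_code_def code_hd_tl snf_nfa_code_def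
      code_nfa_states[symmetric] code_nfa_final[symmetric] code_nfa_trans[symmetric] k
    by (simp only: nfa_map_def nfa.simps) (simp add: snf_nfa_def state_code_def)
qed

end

theorem theorem3p6:
  "(\<forall>(\<Sigma> :: 'a set) (D :: 'd set) (A :: ('s, 'a, nat) session_automaton) (k :: nat).
      finite \<Sigma> \<and> \<Sigma> \<noteq> {} \<and> infinite D \<and>
      is_session_automaton \<Sigma> A \<and> registers A = {1..k} \<longrightarrow>
        bounded_language k (sa_language \<Sigma> D A) \<and>
        regular (\<Sigma> \<times> Gamma k) (snf ` sa_language \<Sigma> D A))
   \<and>
   (\<exists>(f :: nat \<Rightarrow> nat) (p :: nat poly). computable f \<and>
      (\<forall>(\<Sigma> :: 'a set) (D :: 'd set) (A :: ('s, 'a, nat) session_automaton) (k :: nat)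
          (es :: 's \<Rightarrow> nat) (ea :: 'a \<Rightarrow> nat).
         finite \<Sigma> \<and> \<Sigma> \<noteq> {} \<and> infinite D \<and>
         is_session_automaton \<Sigma> A \<and> registers A = {1..k} \<and>
         inj_on es (states A) \<and> inj_on ea \<Sigma> \<longrightarrow>
           (\<exists>B :: (nat, 'a \<times> nat action) nfa.
              f (sa_code es ea A) = nfa_code ea B \<and>
              is_nfa (\<Sigma> \<times> Gamma k) B \<and>
              nfa_language B = snf ` sa_language \<Sigma> D A \<and>
              card (nfa_states B) \<le> card (states A) * 2 ^ poly p k)))"
proof -
  \<comment> \<open>The polynomial \<open>[:0, 0, 1:]\<close> is the square, from the
    \<open>k * k\<close> pairs on which the relation in a state is chosen.\<close>
  have main: "is_nfa (\<Sigma> \<times> Gamma k) B" "nfa_language B = snf ` sa_language \<Sigma> D A"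
    "card (nfa_states B) \<le> card (states A) * 2 ^ poly [:0, 0, 1:] k"
    if "finite \<Sigma>" "infinite D" and A: "is_session_automaton \<Sigma> A" "registers A = {1..k}"
      and es: "inj_on es (states A)" and B: "B = nfa_map (state_code es) (snf_nfa k A)"
    for \<Sigma> :: "'a set" and D :: "'d set" and A :: "('s, 'a, nat) session_automaton" and k es B
  proof -
    note nfa = is_nfa_snf_nfa[OF A \<open>finite \<Sigma>\<close>]
    show "is_nfa (\<Sigma> \<times> Gamma k) B" unfolding B by (rule is_nfa_map[OF nfa])
    show "nfa_language B = snf ` sa_language \<Sigma> D A"
      unfolding B nfa_language_map[OF nfa inj_state_code[OF A es]]
      by (rule nfa_language_snf_nfa[OF A \<open>infinite D\<close>])
    have "card (nfa_states B) \<le> card (nfa_states (snf_nfa k A))"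
      using nfa unfolding B by (simp add: nfa_map_def is_nfa_def card_image_le)
    then show "card (nfa_states B) \<le> card (states A) * 2 ^ poly [:0, 0, 1:] k"
      by (simp add: card_snf_nfa_states[OF A])
  qed
  show ?thesis
  proof (intro conjI allI impI)
    fix \<Sigma> :: "'a set" and D :: "'d set" and A :: "('s, 'a, nat) session_automaton" and k
    assume *: "finite \<Sigma> \<and> \<Sigma> \<noteq> {} \<and> infinite D \<and> is_session_automaton \<Sigma> A \<and> registers A = {1..k}"
    then show "bounded_language k (sa_language \<Sigma> D A)" by (intro sa_language_bounded) auto
    \<comment> \<open>Regularity comes without a numbering of the states, so one is chosen to obtain
      an automaton on natural numbers.\<close>
    have "finite (states A)" using * by (simp add: is_session_automaton_def)
    then obtain es :: "'s \<Rightarrow> nat" where "inj_on es (states A)"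
      using finite_imp_inj_to_nat_seg by blast
    then show "regular (\<Sigma> \<times> Gamma k) (snf ` sa_language \<Sigma> D A)"
      unfolding regular_def using main(1,2)[OF _ _ _ _ _ refl, of \<Sigma> D A k es] *
      by (intro exI[of _ "nfa_map (state_code es) (snf_nfa k A)"]) simp
  next
    show "\<exists>(f :: nat \<Rightarrow> nat) (p :: nat poly). computable f \<and>
      (\<forall>(\<Sigma> :: 'a set) (D :: 'd set) (A :: ('s, 'a, nat) session_automaton) (k :: nat)
          (es :: 's \<Rightarrow> nat) (ea :: 'a \<Rightarrow> nat).
         finite \<Sigma> \<and> \<Sigma> \<noteq> {} \<and> infinite D \<and>
         is_session_automaton \<Sigma> A \<and> registers A = {1..k} \<and>
         inj_on es (states A) \<and> inj_on ea \<Sigma> \<longrightarrow>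
           (\<exists>B :: (nat, 'a \<times> nat action) nfa.
              f (sa_code es ea A) = nfa_code ea B \<and>
              is_nfa (\<Sigma> \<times> Gamma k) B \<and>
              nfa_language B = snf ` sa_language \<Sigma> D A \<and>
              card (nfa_states B) \<le> card (states A) * 2 ^ poly p k))"
    proof (rule exI[of _ snf_compile], rule exI[of _ "[:0, 0, 1:]"], intro conjI allI impI)
      fix \<Sigma> :: "'a set" and D :: "'d set" and A :: "('s, 'a, nat) session_automaton" and k
        and es :: "'s \<Rightarrow> nat" and ea :: "'a \<Rightarrow> nat"
      assume *: "finite \<Sigma> \<and> \<Sigma> \<noteq> {} \<and> infinite D \<and> is_session_automaton \<Sigma> A \<and>
        registers A = {1..k} \<and> inj_on es (states A) \<and> inj_on ea \<Sigma>"
      show "\<exists>B. snf_compile (sa_code es ea A) = nfa_code ea B \<and> is_nfa (\<Sigma> \<times> Gamma k) B \<and>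
        nfa_language B = snf ` sa_language \<Sigma> D A \<and>
        card (nfa_states B) \<le> card (states A) * 2 ^ poly [:0, 0, 1:] k"
      proof (intro exI conjI)
        show "snf_compile (sa_code es ea A) = nfa_code ea (nfa_map (state_code es) (snf_nfa k A))"
          using * by (intro snf_compile_sa_code) auto
      qed (use * main[OF _ _ _ _ _ refl, of \<Sigma> D A k es] in simp_all)
    qed (rule computable_snf_compile)
  qed
qed

end
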